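(* Let $(K,\mathcal{O})$ be an infinite valued field of positive characteristic (i.e. $K$ is an infinite field of positive characteristic and $\mathcal{O}$ is a valuation ring on $K$). If the theory $\mathrm{Th}(K,\mathcal{O})$ of the valued field is $n$-dependent for some $n\in\mathbb{N}$, $n\geq 1$, then $(K,\mathcal{O})$ is henselian.
   Context: $(K,\mathcal{O})$ is viewed as a first-order structure: the field $K$ in the ring language together with a unary predicate for $\mathcal{O}$. A partitioned formula $\varphi(x;y_1,\ldots,y_n)$ (variables are finite tuples) has the $n$-independence property with respect to a theory $T$ if in some model of $T$ there is a sequence of tuples $(a_{1,i},\ldots,a_{n,i})_{i\in\omega}$ such that for every $s\subseteq\omega^n$ there is a tuple $b_s$ with $\models\varphi(b_s;a_{1,i_1},\ldots,a_{n,i_n})\Leftrightarrow (i_1,\ldots,i_n)\in s$; otherwise it is $n$-dependent. A theory is $n$-dependent if every formula is $n$-dependent with respect to it. *)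

theory Defs
  imports "HOL-Computational_Algebra.Polynomial"
begin
datatype tm =
    Var nat
  | TZero
  | TOne
  | TAdd tm tm
  | TMinus tm
  | TMult tm tm

datatype fm =
    Eq tm tm
  | InVal tm
  | Neg fm
  | Conj fm fm
  | Ex nat fm

primrec fv_tm :: "tm \<Rightarrow> nat set" where
  "fv_tm (Var v) = {v}"
| "fv_tm TZero = {}"
| "fv_tm TOne = {}"
| "fv_tm (TAdd s t) = fv_tm s \<union> fv_tm t"
| "fv_tm (TMinus t) = fv_tm t"
| "fv_tm (TMult s t) = fv_tm s \<union> fv_tm t"

primrec fv :: "fm \<Rightarrow> nat set" where
  "fv (Eq s t) = fv_tm s \<union> fv_tm t"
| "fv (InVal t) = fv_tm t"
| "fv (Neg \<phi>) = fv \<phi>"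
| "fv (Conj \<phi> \<psi>) = fv \<phi> \<union> fv \<psi>"
| "fv (Ex v \<phi>) = fv \<phi> - {v}"

record 'm vf_struct =
  dom :: "'m set"
  zero_of :: 'm
  one_of :: 'm
  add_of :: "'m \<Rightarrow> 'm \<Rightarrow> 'm"
  minus_of :: "'m \<Rightarrow> 'm"
  mult_of :: "'m \<Rightarrow> 'm \<Rightarrow> 'm"
  val_of :: "'m set"

definition is_structure :: "'m vf_struct \<Rightarrow> bool" where
  "is_structure M \<longleftrightarrow>
     dom M \<noteq> {} \<and> zero_of M \<in> dom M \<and> one_of M \<in> dom M \<and>
     (\<forall>a\<in>dom M. \<forall>b\<in>dom M. add_of M a b \<in> dom M) \<and>
     (\<forall>a\<in>dom M. minus_of M a \<in> dom M) \<and>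
     (\<forall>a\<in>dom M. \<forall>b\<in>dom M. mult_of M a b \<in> dom M) \<and>
     val_of M \<subseteq> dom M"

primrec eval_tm :: "'m vf_struct \<Rightarrow> (nat \<Rightarrow> 'm) \<Rightarrow> tm \<Rightarrow> 'm" where
  "eval_tm M e (Var v) = e v"
| "eval_tm M e TZero = zero_of M"
| "eval_tm M e TOne = one_of M"
| "eval_tm M e (TAdd s t) = add_of M (eval_tm M e s) (eval_tm M e t)"
| "eval_tm M e (TMinus t) = minus_of M (eval_tm M e t)"
| "eval_tm M e (TMult s t) = mult_of M (eval_tm M e s) (eval_tm M e t)"

primrec sat :: "'m vf_struct \<Rightarrow> (nat \<Rightarrow> 'm) \<Rightarrow> fm \<Rightarrow> bool" where
  "sat M e (Eq s t) \<longleftrightarrow> eval_tm M e s = eval_tm M e t"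
| "sat M e (InVal t) \<longleftrightarrow> eval_tm M e t \<in> val_of M"
| "sat M e (Neg \<phi>) \<longleftrightarrow> \<not> sat M e \<phi>"
| "sat M e (Conj \<phi> \<psi>) \<longleftrightarrow> sat M e \<phi> \<and> sat M e \<psi>"
| "sat M e (Ex v \<phi>) \<longleftrightarrow> (\<exists>a\<in>dom M. sat M (e(v := a)) \<phi>)"

definition true_in :: "'m vf_struct \<Rightarrow> fm \<Rightarrow> bool" where
  "true_in M \<phi> \<longleftrightarrow> (\<forall>e. range e \<subseteq> dom M \<longrightarrow> sat M e \<phi>)"

definition Th :: "'m vf_struct \<Rightarrow> fm set" where
  "Th M = {\<phi>. fv \<phi> = {} \<and> true_in M \<phi>}"

definition is_model :: "'m vf_struct \<Rightarrow> fm set \<Rightarrow> bool" where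
  "is_model M T \<longleftrightarrow> is_structure M \<and> (\<forall>\<phi>\<in>T. true_in M \<phi>)"

text \<open>
  A partition \<open>\<phi>(x; y\<^sub>1, \<dots>, y\<^sub>n)\<close> of the variables of a formula is given by the list
  \<open>xs\<close> of the variables in the tuple \<open>x\<close> and the list \<open>yss\<close> of the \<open>n\<close> lists of variables
  in \<open>y\<^sub>1, \<dots>, y\<^sub>n\<close> (indexed from \<open>0\<close>); all these variables are pairwise distinct.
\<close>

definition partitioned :: "nat \<Rightarrow> fm \<Rightarrow> nat list \<Rightarrow> nat list list \<Rightarrow> bool" where
  "partitioned n \<phi> xs yss \<longleftrightarrow>
     length yss = n \<and> distinct (xs @ concat yss) \<and> fv \<phi> \<subseteq> set (xs @ concat yss)"

text \<open>
  The variables in \<open>vs\<close> are sent to the corresponding entries of \<open>cs\<close>; the value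
  at other variables is irrelevant below, as those do not occur free.
\<close>

definition assign :: "nat list \<Rightarrow> 'm list \<Rightarrow> nat \<Rightarrow> 'm" where
  "assign vs cs v = (case map_of (zip vs cs) v of Some c \<Rightarrow> c | None \<Rightarrow> undefined)"

definition tuples :: "'m vf_struct \<Rightarrow> nat \<Rightarrow> 'm list set" where
  "tuples M l = {c. length c = l \<and> set c \<subseteq> dom M}"

text \<open>
  An element of \<open>\<omega>\<^sup>n\<close> is a list of naturals of length \<open>n\<close>. A formula of HOL cannot
  quantify over the models of \<open>T\<close> in all types, so the type \<open>'m\<close> in which the models
  live is a parameter (their domains are arbitrary subsets of \<open>'m\<close>). As the language is
  countable, and an instance of the \<open>n\<close>-independence property involves at most
  continuum many tuples, the downward Loewenheim-Skolem theorem shows that every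
  \<open>'m\<close> of cardinality at least that of the continuum yields the same notion as
  quantifying over all models; for instance \<open>'m = (nat \<Rightarrow> 'a)\<close> for a type \<open>'a\<close> with at
  least two elements.
\<close>

definition has_IP :: "'m itself \<Rightarrow> nat \<Rightarrow> fm set \<Rightarrow> fm \<Rightarrow> nat list \<Rightarrow> nat list list \<Rightarrow> bool" where
  "has_IP TYPE('m) n T \<phi> xs yss \<longleftrightarrow>
     (\<exists>(M :: 'm vf_struct) a. is_model M T \<and>
        (\<forall>k<n. \<forall>i::nat. a k i \<in> tuples M (length (yss ! k))) \<and>
        (\<forall>s \<subseteq> {\<iota>. length \<iota> = n}. \<exists>b \<in> tuples M (length xs).
           \<forall>\<iota>. length \<iota> = n \<longrightarrow>
             (sat M (assign (xs @ concat yss) (b @ concat (map (\<lambda>k. a k (\<iota> ! k)) [0..<n]))) \<phi>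
               \<longleftrightarrow> \<iota> \<in> s)))"

definition n_dependent :: "'m itself \<Rightarrow> nat \<Rightarrow> fm set \<Rightarrow> bool" where
  "n_dependent TYPE('m) n T \<longleftrightarrow>
     (\<forall>\<phi> xs yss. partitioned n \<phi> xs yss \<longrightarrow> \<not> has_IP TYPE('m) n T \<phi> xs yss)"

definition valuation_ring :: "'a::field set \<Rightarrow> bool" where
  "valuation_ring \<O> \<longleftrightarrow>
     1 \<in> \<O> \<and> (\<forall>a\<in>\<O>. \<forall>b\<in>\<O>. a - b \<in> \<O>) \<and> (\<forall>a\<in>\<O>. \<forall>b\<in>\<O>. a * b \<in> \<O>) \<and>
     (\<forall>a. a \<noteq> 0 \<longrightarrow> a \<in> \<O> \<or> inverse a \<in> \<O>)"

definition valued_field :: "'a::field set \<Rightarrow> 'a vf_struct" where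
  "valued_field \<O> =
     \<lparr>dom = UNIV, zero_of = 0, one_of = 1, add_of = (+), minus_of = uminus,
      mult_of = (*), val_of = \<O>\<rparr>"

definition max_ideal :: "'a::field set \<Rightarrow> 'a set" where
  "max_ideal \<O> = {a \<in> \<O>. \<not> (\<exists>b\<in>\<O>. a * b = 1)}"

text \<open>
  Henselianity in the form of Hensel's lemma: every simple zero in the residue field
  of a polynomial over \<open>\<O>\<close> lifts to a zero in \<open>\<O>\<close>. The trivial valuation ring
  \<open>\<O> = K\<close> is allowed.
\<close>

definition henselian :: "'a::field set \<Rightarrow> bool" where
  "henselian \<O> \<longleftrightarrow> valuation_ring \<O> \<and>
     (\<forall>f a. (\<forall>i. coeff f i \<in> \<O>) \<and> a \<in> \<O> \<and>
        poly f a \<in> max_ideal \<O> \<and> poly (pderiv f) a \<notin> max_ideal \<O> \<longrightarrow>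
        (\<exists>b\<in>\<O>. poly f b = 0 \<and> b - a \<in> max_ideal \<O>))"

end

(*
  Henselianity of a valuation ring R is lifting of idempotents: after a substitution one has to split
  off a root r = -1 (mod m) of a monic h over R with h = X^(d-1)(X+1) (mod m). In characteristic p
  the idempotent e = (-X)^(d-1) modulo m lifts as soon as u |-> u^p - u maps m[X]/h onto itself:
  correct e to e' with e'^p = e' in R[X]/h and take e'^(p-1).

  Surjectivity comes from n-dependence. Let V be a definable ideal of a valuation ring R with infinite
  residue field and S the image of u |-> u^p - u on V[X]/h. Every v^p is congruent to v modulo S.
  Hence for s outside S and a = b^(p^N), the element x = sum_(l<N) (f_l s)^(p^(N-l)) satisfies
  a x = (sum_(l<N) f_l b^(p^l)) s (mod S), and the f_l can be chosen in R so that the additive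
  polynomial sum_l f_l X^(p^l) takes arbitrary values 0 or 1 at 1, t, ..., t^(N-1) for a suitable t.
  So the relation "a_1 ... a_n x in S" carries arbitrary finite patterns on an n-dimensional grid of
  powers of t, and an ultrapower turns these into the n-independence property. Applied to R = V = K
  this shows that K is Artin-Schreier closed, so that the residue field of the given valuation ring
  is infinite; applied to its maximal ideal it yields henselianity.
*)

theory Submission
  imports Defs "HOL-Computational_Algebra.Primes"
begin

section \<open>Ultrapowers and finite patterns\<close>

lemma eval_tm_cong:
  "(\<And>v. v \<in> fv_tm t \<Longrightarrow> e v = e' v) \<Longrightarrow> eval_tm M e t = eval_tm M e' t"
  by (induction t) auto

lemma sat_cong:
  "(\<And>v. v \<in> fv \<phi> \<Longrightarrow> e v = e' v) \<Longrightarrow> sat M e \<phi> \<longleftrightarrow> sat M e' \<phi>"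
proof (induction \<phi> arbitrary: e e')
  case (Eq s t)
  then show ?case using eval_tm_cong[of s e e'] eval_tm_cong[of t e e'] by simp
next
  case (InVal t)
  then show ?case using eval_tm_cong[of t e e'] by simp
next
  case (Neg \<phi>)
  have "sat M e \<phi> \<longleftrightarrow> sat M e' \<phi>" using Neg.prems by (intro Neg.IH) simp
  then show ?case by simp
next
  case (Conj \<phi> \<psi>)
  have "sat M e \<phi> \<longleftrightarrow> sat M e' \<phi>" using Conj.prems by (intro Conj.IH(1)) simp
  moreover have "sat M e \<psi> \<longleftrightarrow> sat M e' \<psi>" using Conj.prems by (intro Conj.IH(2)) simp
  ultimately show ?case by simp
next
  case (Ex v \<phi>)
  have "sat M (e(v := a)) \<phi> \<longleftrightarrow> sat M (e'(v := a)) \<phi>" for a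
    using Ex.prems by (intro Ex.IH) auto
  then show ?case by simp
qed

section \<open>Existence of ultrafilters\<close>

definition ultrafilter :: "'i filter \<Rightarrow> bool" where
  "ultrafilter U \<longleftrightarrow> U \<noteq> bot \<and> (\<forall>P. eventually P U \<or> eventually (\<lambda>x. \<not> P x) U)"

lemma ultrafilter_eventually_not:
  assumes "ultrafilter U"
  shows "eventually (\<lambda>x. \<not> P x) U \<longleftrightarrow> \<not> eventually P U"
  using assms eventually_conj[of P U "\<lambda>x. \<not> P x"] by (auto simp: ultrafilter_def trivial_limit_def)

text \<open>In the order on filters, smaller means finer, so Zorn's lemma is applied to the reversed
  order. A minimal proper filter decides every \<open>P\<close>: its meet with the principal filter
  of \<open>P\<close> is either improper or the filter itself.\<close>

lemma ex_ultrafilter: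
  assumes "F \<noteq> bot"
  shows "\<exists>U\<le>F. ultrafilter U"
proof -
  define A where "A = {G. G \<noteq> bot \<and> G \<le> F}"
  have "\<exists>U\<in>A. \<forall>G\<in>A. U \<ge> G \<longrightarrow> G = U"
  proof (rule predicate_Zorn)
    show "partial_order_on A (relation_of (\<ge>) A)"
      by (intro partial_order_on_relation_ofI) auto
  next
    fix C assume C: "C \<in> Chains (relation_of (\<ge>) A)"
    show "\<exists>u\<in>A. \<forall>a\<in>C. a \<ge> u"
    proof (cases "C = {}")
      case True
      then show ?thesis using assms by (auto simp: A_def)
    next
      case False
      have CA: "C \<subseteq> A" using Chains_relation_of[OF C] .
      have "\<exists>x\<in>C. x \<le> inf G H" if "G \<in> C" "H \<in> C" for G H
        using that C unfolding Chains_def relation_of_def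
        by (auto simp: le_iff_inf inf.commute) (metis le_iff_inf inf.commute order_refl)+
      \<comment> \<open>As \<open>C\<close> is a chain, what holds eventually in its infimum already
        holds eventually in a member; hence the infimum is proper.\<close>
      then have "eventually (\<lambda>_. False) (Inf C) \<longleftrightarrow> (\<exists>b\<in>C. eventually (\<lambda>_. False) b)"
        using False by (intro eventually_Inf_base) auto
      then have "Inf C \<noteq> bot" using CA by (auto simp: A_def trivial_limit_def)
      moreover have "Inf C \<le> F"
      proof -
        obtain G where "G \<in> C" using False by blast
        then show ?thesis using CA by (intro Inf_lower2[of G]) (auto simp: A_def)
      qed
      ultimately show ?thesis by (intro bexI[of _ "Inf C"]) (auto simp: A_def intro: Inf_lower)
    qed
  qed
  then obtain U where U: "U \<noteq> bot" "U \<le> F" and min: "\<And>G. G \<noteq> bot \<Longrightarrow> G \<le> U \<Longrightarrow> G = U"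
    by (auto simp: A_def)
  have "eventually P U \<or> eventually (\<lambda>x. \<not> P x) U" for P
  proof (cases "inf U (principal {x. P x}) = bot")
    case True
    then have "eventually (\<lambda>_. False) (inf U (principal {x. P x}))" by simp
    then show ?thesis by (simp add: eventually_inf_principal)
  next
    case False
    from min[OF this] have "U \<le> principal {x. P x}" by (metis inf.cobounded1 inf.cobounded2)
    then show ?thesis by (simp add: le_principal)
  qed
  with U show ?thesis by (auto simp: ultrafilter_def)
qed

section \<open>Ultrapowers and Los's theorem\<close>

text \<open>
  Classes of functions modulo \<open>U\<close> are represented by chosen members, so that the ultrapower
  lives in the function type itself.
\<close>

definition urep :: "'i filter \<Rightarrow> ('i \<Rightarrow> 'a) \<Rightarrow> 'i \<Rightarrow> 'a" where
  "urep U f = (SOME g. \<forall>\<^sub>F i in U. g i = f i)"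

lemma eventually_urep: "\<forall>\<^sub>F i in U. urep U f i = f i"
  unfolding urep_def by (rule someI[of _ f]) simp

lemma urep_eq_iff: "urep U f = urep U g \<longleftrightarrow> (\<forall>\<^sub>F i in U. f i = g i)"
proof
  assume "urep U f = urep U g"
  then show "\<forall>\<^sub>F i in U. f i = g i"
    using eventually_urep[of U f] eventually_urep[of U g] by (auto elim: eventually_elim2)
next
  assume *: "\<forall>\<^sub>F i in U. f i = g i"
  have "(\<forall>\<^sub>F i in U. h i = f i) \<longleftrightarrow> (\<forall>\<^sub>F i in U. h i = g i)" for h
    using * by (auto elim: eventually_elim2)
  then show "urep U f = urep U g" by (simp add: urep_def)
qed

lemma urep_urep: "urep U (urep U f) = urep U f"
  by (simp add: urep_eq_iff eventually_urep)

definition ultrapower :: "'i filter \<Rightarrow> 'a vf_struct \<Rightarrow> ('i \<Rightarrow> 'a) vf_struct" where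
  "ultrapower U M =
     \<lparr>dom = range (urep U), zero_of = urep U (\<lambda>_. zero_of M), one_of = urep U (\<lambda>_. one_of M),
      add_of = (\<lambda>f g. urep U (\<lambda>i. add_of M (f i) (g i))),
      minus_of = (\<lambda>f. urep U (\<lambda>i. minus_of M (f i))),
      mult_of = (\<lambda>f g. urep U (\<lambda>i. mult_of M (f i) (g i))),
      val_of = {f \<in> range (urep U). \<forall>\<^sub>F i in U. f i \<in> val_of M}\<rparr>"

lemma eval_tm_ultrapower:
  "eval_tm (ultrapower U M) (\<lambda>v. urep U (e v)) t = urep U (\<lambda>i. eval_tm M (\<lambda>v. e v i) t)"
proof -
  have *: "urep U (\<lambda>i. F (urep U f i)) = urep U (\<lambda>i. F (f i))" for f and F :: "'b \<Rightarrow> 'b"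
    using eventually_urep[of U f] unfolding urep_eq_iff by eventually_elim simp
  have **: "urep U (\<lambda>i. F (urep U f i) (urep U g i)) = urep U (\<lambda>i. F (f i) (g i))"
    for f g and F :: "'b \<Rightarrow> 'b \<Rightarrow> 'b"
    using eventually_urep[of U f] eventually_urep[of U g] unfolding urep_eq_iff
    by eventually_elim simp
  show ?thesis
    by (induction t) (simp_all add: ultrapower_def * **)
qed

text \<open>Los's theorem. Negation is where \<open>U\<close> must be an ultrafilter; a quantifier
  is handled by choosing witnesses index by index.\<close>

theorem sat_ultrapower:
  assumes "ultrafilter U" "dom M = UNIV"
  shows "sat (ultrapower U M) (\<lambda>v. urep U (e v)) \<phi> \<longleftrightarrow> (\<forall>\<^sub>F i in U. sat M (\<lambda>v. e v i) \<phi>)"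
proof (induction \<phi> arbitrary: e)
  case (Eq s t)
  then show ?case by (simp add: eval_tm_ultrapower urep_eq_iff)
next
  case (InVal t)
  have "(\<forall>\<^sub>F i in U. urep U f i \<in> val_of M) \<longleftrightarrow> (\<forall>\<^sub>F i in U. f i \<in> val_of M)" for f
    using eventually_urep[of U f] by (auto elim: eventually_elim2)
  then show ?case by (simp add: eval_tm_ultrapower) (simp add: ultrapower_def)
next
  case (Neg \<phi>)
  then show ?case by (simp add: ultrafilter_eventually_not[OF assms(1)])
next
  case (Conj \<phi> \<psi>)
  then show ?case by (simp add: eventually_conj_iff)
next
  case (Ex v \<phi>)
  have "(\<lambda>w. urep U (e w))(v := urep U f) = (\<lambda>w. urep U ((e(v := f)) w))" for f by auto
  then have "sat (ultrapower U M) (\<lambda>v. urep U (e v)) (Ex v \<phi>)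
      \<longleftrightarrow> (\<exists>f. \<forall>\<^sub>F i in U. sat M (\<lambda>w. (e(v := f)) w i) \<phi>)"
    using Ex.IH by (simp add: ultrapower_def)
  also have "\<dots> \<longleftrightarrow> (\<exists>f. \<forall>\<^sub>F i in U. sat M ((\<lambda>w. e w i)(v := f i)) \<phi>)"
  proof -
    have "(\<lambda>w. (e(v := f)) w i) = (\<lambda>w. e w i)(v := f i)" for f i by auto
    then show ?thesis by simp
  qed
  also have "\<dots> \<longleftrightarrow> (\<forall>\<^sub>F i in U. \<exists>a. sat M ((\<lambda>w. e w i)(v := a)) \<phi>)"
  proof
    assume "\<forall>\<^sub>F i in U. \<exists>a. sat M ((\<lambda>w. e w i)(v := a)) \<phi>"
    then show "\<exists>f. \<forall>\<^sub>F i in U. sat M ((\<lambda>w. e w i)(v := f i)) \<phi>"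
      by (intro exI[of _ "\<lambda>i. SOME a. sat M ((\<lambda>w. e w i)(v := a)) \<phi>"])
        (auto elim!: eventually_mono intro: someI)
  qed (auto elim: eventually_mono)
  finally show ?case using assms(2) by simp
qed

lemma is_model_ultrapower:
  assumes "ultrafilter U" "dom M = UNIV"
  shows "is_model (ultrapower U M) (Th M)"
  unfolding is_model_def
proof (intro conjI ballI)
  show "is_structure (ultrapower U M)" by (auto simp: is_structure_def ultrapower_def)
next
  fix \<phi> assume \<phi>: "\<phi> \<in> Th M"
  show "true_in (ultrapower U M) \<phi>"
    unfolding true_in_def
  proof (intro allI impI)
    fix e :: "nat \<Rightarrow> 'a \<Rightarrow> 'b" assume "range e \<subseteq> dom (ultrapower U M)"
    \<comment> \<open>Elements of the ultrapower are fixed by \<open>urep U\<close>, so every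
      assignment into it has the form that Los's theorem treats.\<close>
    then have "urep U (e v) = e v" for v by (auto simp: ultrapower_def urep_urep dest!: range_subsetD[of _ _ v])
    then have "sat (ultrapower U M) e \<phi> \<longleftrightarrow> (\<forall>\<^sub>F i in U. sat M (\<lambda>v. e v i) \<phi>)"
      using sat_ultrapower[OF assms, of e \<phi>] by simp
    then show "sat (ultrapower U M) e \<phi>" using \<phi> assms(2) by (simp add: Th_def true_in_def)
  qed
qed

section \<open>From finite patterns to the n-independence property\<close>

text \<open>Turns a family of \<open>l\<close>-tuples into one \<open>l\<close>-tuple of the
  ultrapower, coordinate by coordinate.\<close>

definition ulift :: "'i filter \<Rightarrow> ('i \<Rightarrow> 'a list) \<Rightarrow> nat \<Rightarrow> ('i \<Rightarrow> 'a) list" where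
  "ulift U X l = map (\<lambda>j. urep U (\<lambda>i. X i ! j)) [0..<l]"

lemma ulift_append:
  assumes "\<And>i. length (X i) = l"
  shows "ulift U (\<lambda>i. X i @ Y i) (l + l') = ulift U X l @ ulift U Y l'"
  by (rule nth_equalityI) (auto simp: ulift_def nth_append assms)

lemma ulift_concat:
  assumes "\<And>i k. k \<in> set ks \<Longrightarrow> length (X i k) = l k"
  shows "concat (map (\<lambda>k. ulift U (\<lambda>i. X i k) (l k)) ks)
    = ulift U (\<lambda>i. concat (map (X i) ks)) (sum_list (map l ks))"
  using assms
proof (induction ks)
  case Nil then show ?case by (simp add: ulift_def)
next
  case (Cons k ks)
  then show ?case by (simp add: ulift_append)
qed

lemma ulift_in_tuples: "ulift U X l \<in> tuples (ultrapower U M) l"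
  by (auto simp: tuples_def ulift_def ultrapower_def)

lemma assign_nth:
  assumes "distinct vs" "length cs = length vs" "j < length vs"
  shows "assign vs cs (vs ! j) = cs ! j"
proof -
  have "map_of (zip vs cs) (vs ! j) = Some (cs ! j)"
    using assms by (intro map_of_is_SomeI) (auto simp: in_set_zip)
  then show ?thesis by (simp add: assign_def)
qed

text \<open>Compactness made concrete: coordinate \<open>D\<close> of an ultrapower over the
  naturals carries a pattern on the box of side \<open>D\<close>, and a fixed grid point lies in
  almost all of these boxes. The ultrapower lives in the type \<open>nat \<Rightarrow> 'a\<close> of
  the conclusion.\<close>

theorem has_IP_if_finite_patterns:
  fixes M :: "'a vf_struct"
  assumes M: "dom M = UNIV" and part: "partitioned n \<phi> xs yss"
    and pat: "\<And>D :: nat. \<exists>a. (\<forall>k<n. \<forall>i. length (a k i) = length (yss ! k)) \<and>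
      (\<forall>s. \<exists>b. length b = length xs \<and> (\<forall>\<iota>. length \<iota> = n \<longrightarrow> set \<iota> \<subseteq> {..<D} \<longrightarrow>
        (sat M (assign (xs @ concat yss) (b @ concat (map (\<lambda>k. a k (\<iota> ! k)) [0..<n]))) \<phi> \<longleftrightarrow> \<iota> \<in> s)))"
  shows "has_IP TYPE(nat \<Rightarrow> 'a) n (Th M) \<phi> xs yss"
proof -
  \<comment> \<open>\<open>U\<close> is nonprincipal: everything that holds for all large
    \<open>D\<close> holds on a set in \<open>U\<close>.\<close>
  obtain U :: "nat filter" where U: "U \<le> sequentially" "ultrafilter U"
    using ex_ultrafilter[of sequentially] by auto
  let ?Q = "\<lambda>(D :: nat) a b s. \<forall>\<iota>. length \<iota> = n \<longrightarrow> set \<iota> \<subseteq> {..<D} \<longrightarrow>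
    (sat M (assign (xs @ concat yss) (b @ concat (map (\<lambda>k. a k (\<iota> ! k)) [0..<n]))) \<phi> \<longleftrightarrow> \<iota> \<in> s)"
  define good where "good D a \<longleftrightarrow> (\<forall>k<n. \<forall>i. length (a k i) = length (yss ! k)) \<and>
      (\<forall>s. \<exists>b. length b = length xs \<and> ?Q D a b s)" for D a
  define A where "A D = (SOME a. good D a)" for D
  have good: "good D (A D)" for D
    unfolding A_def by (rule someI_ex[of "good D"]) (unfold good_def, rule pat)
  then have A: "\<And>D k i. k < n \<Longrightarrow> length (A D k i) = length (yss ! k)"
    by (simp add: good_def)
  define B where "B D s = (SOME b. length b = length xs \<and> ?Q D (A D) b s)" for D s
  have "length (B D s) = length xs \<and> ?Q D (A D) (B D s) s" for D s
    unfolding B_def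
    by (rule someI_ex[of "\<lambda>b. length b = length xs \<and> ?Q D (A D) b s"])
      (rule good[unfolded good_def, THEN conjunct2, THEN spec])
  then have B: "\<And>D s. length (B D s) = length xs" and AB: "\<And>D s. ?Q D (A D) (B D s) s"
    by blast+
  define a where "a k i = ulift U (\<lambda>D. A D k i) (length (yss ! k))" for k i
  define b where "b s = ulift U (\<lambda>D. B D s) (length xs)" for s
  define vs where "vs = xs @ concat yss"
  have vs: "distinct vs" "fv \<phi> \<subseteq> set vs" "length yss = n" using part by (auto simp: partitioned_def vs_def)
  have yss: "sum_list (map (\<lambda>k. length (yss ! k)) [0..<n]) = length (concat yss)"
  proof -
    have "map (\<lambda>k. length (yss ! k)) [0..<n] = map length yss"
      using vs(3) by (intro nth_equalityI) auto
    then show ?thesis by (simp add: length_concat)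
  qed
  have "sat (ultrapower U M) (assign vs (b s @ concat (map (\<lambda>k. a k (\<iota> ! k)) [0..<n]))) \<phi> \<longleftrightarrow> \<iota> \<in> s"
    if \<iota>: "length \<iota> = n" for s \<iota>
  proof -
    define cs where "cs D = B D s @ concat (map (\<lambda>k. A D k (\<iota> ! k)) [0..<n])" for D
    have len: "length (cs D) = length vs" for D
    proof -
      have "(\<Sum>k\<leftarrow>[0..<n]. length (A D k (\<iota> ! k))) = (\<Sum>k\<leftarrow>[0..<n]. length (yss ! k))"
        using A by (intro arg_cong[of _ _ sum_list] map_cong) auto
      then show ?thesis using B yss by (simp add: cs_def vs_def length_concat comp_def)
    qed
    have "b s @ concat (map (\<lambda>k. a k (\<iota> ! k)) [0..<n])
        = b s @ ulift U (\<lambda>D. concat (map (\<lambda>k. A D k (\<iota> ! k)) [0..<n])) (length (concat yss))"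
      unfolding a_def using A by (subst ulift_concat) (auto simp: yss)
    also have "\<dots> = ulift U cs (length vs)"
      unfolding b_def cs_def using B by (simp add: ulift_append vs_def)
    finally have eq: "b s @ concat (map (\<lambda>k. a k (\<iota> ! k)) [0..<n]) = ulift U cs (length vs)" .
    have "assign vs (ulift U cs (length vs)) v = urep U (\<lambda>D. assign vs (cs D) v)" if v: "v \<in> set vs" for v
    proof -
      obtain j where "j < length vs" "v = vs ! j" using v by (metis in_set_conv_nth)
      then show ?thesis using vs(1) len by (simp add: assign_nth ulift_def)
    qed
    then have "sat (ultrapower U M) (assign vs (ulift U cs (length vs))) \<phi>
        \<longleftrightarrow> sat (ultrapower U M) (\<lambda>v. urep U (\<lambda>D. assign vs (cs D) v)) \<phi>"
      using vs(2) by (intro sat_cong) auto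
    also have "\<dots> \<longleftrightarrow> (\<forall>\<^sub>F D in U. sat M (assign vs (cs D)) \<phi>)"
      by (simp add: sat_ultrapower[OF U(2) M])
    also have "\<dots> \<longleftrightarrow> (\<forall>\<^sub>F D in U. \<iota> \<in> s)"
    proof (rule eventually_subst)
      have "set \<iota> \<subseteq> {..<D}" if "Suc (Max (set \<iota>)) \<le> D" for D
      proof
        fix x assume "x \<in> set \<iota>"
        then have "x \<le> Max (set \<iota>)" by simp
        then show "x \<in> {..<D}" using that by simp
      qed
      then have "\<forall>\<^sub>F D in sequentially. set \<iota> \<subseteq> {..<D}"
        unfolding eventually_sequentially by blast
      then have "\<forall>\<^sub>F D in U. set \<iota> \<subseteq> {..<D}" by (rule filter_leD[OF U(1)])
      then show "\<forall>\<^sub>F D in U. sat M (assign vs (cs D)) \<phi> \<longleftrightarrow> \<iota> \<in> s"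
        unfolding cs_def vs_def by (rule eventually_mono) (rule AB[rule_format, OF \<iota>])
    qed
    also have "\<dots> \<longleftrightarrow> \<iota> \<in> s" using U(2) by (simp add: ultrafilter_def eventually_const_iff)
    finally show ?thesis by (simp add: eq)
  qed
  then have ex: "\<exists>b \<in> tuples (ultrapower U M) (length xs). \<forall>\<iota>. length \<iota> = n \<longrightarrow>
    (sat (ultrapower U M) (assign vs (b @ concat (map (\<lambda>k. a k (\<iota> ! k)) [0..<n]))) \<phi> \<longleftrightarrow> \<iota> \<in> s)" for s
    by (intro bexI[of _ "b s"] allI impI) (auto simp: b_def ulift_in_tuples)
  show ?thesis
    unfolding has_IP_def
  proof (rule exI[of _ "ultrapower U M"], rule exI[of _ a], intro conjI allI impI)
    show "is_model (ultrapower U M) (Th M)" by (rule is_model_ultrapower[OF U(2) M])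
    show "a k i \<in> tuples (ultrapower U M) (length (yss ! k))" for k i
      unfolding a_def by (rule ulift_in_tuples)
  qed (rule ex[unfolded vs_def])
qed

section \<open>What n-dependence says about definable predicates\<close>

definition definable_tm :: "'m vf_struct \<Rightarrow> nat set \<Rightarrow> ((nat \<Rightarrow> 'm) \<Rightarrow> 'm) \<Rightarrow> bool" where
  "definable_tm M X f \<longleftrightarrow> (\<exists>t. fv_tm t \<subseteq> X \<and> (\<forall>e. eval_tm M e t = f e))"

text \<open>Predicates on assignments stand in for formulas, so that no formula has to be written
  out explicitly.\<close>

definition definable :: "'m vf_struct \<Rightarrow> nat set \<Rightarrow> ((nat \<Rightarrow> 'm) \<Rightarrow> bool) \<Rightarrow> bool" where
  "definable M X P \<longleftrightarrow> (\<exists>\<phi>. fv \<phi> \<subseteq> X \<and> (\<forall>e. sat M e \<phi> \<longleftrightarrow> P e))"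

text \<open>The layout of the variables: \<open>d\<close> for the tuple \<open>x\<close>, then
  \<open>m\<close> fixed parameters, then one variable for each of the \<open>n\<close> sequences,
  evaluated at the grid point \<open>\<iota>\<close>.\<close>

definition split_env ::
  "nat \<Rightarrow> nat \<Rightarrow> (nat \<Rightarrow> 'm) \<Rightarrow> (nat \<Rightarrow> 'm) \<Rightarrow> (nat \<Rightarrow> nat \<Rightarrow> 'm) \<Rightarrow> nat list \<Rightarrow> nat \<Rightarrow> 'm" where
  "split_env d m b c a \<iota> v =
     (if v < d then b v else if v < d + m then c v else a (v - (d + m)) (\<iota> ! (v - (d + m))))"

text \<open>The finitary form of n-dependence: were there no bound \<open>D\<close> that serves all
  parameters and sequences at once, every box would carry all patterns, and the ultrapower would
  give the n-independence property.\<close>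

theorem n_dependentD:
  fixes M :: "'a vf_struct"
  assumes M: "dom M = UNIV" and dep: "n_dependent TYPE(nat \<Rightarrow> 'a) n (Th M)" and n: "n \<ge> 1"
    and P: "definable M {..<d + m + n} P"
  shows "\<exists>D. \<forall>c a. \<exists>s. \<forall>b. \<exists>\<iota>. length \<iota> = n \<and> set \<iota> \<subseteq> {..<D} \<and>
    \<not> (P (split_env d m b c a \<iota>)
      \<longleftrightarrow> \<iota> \<in> s)"
proof (rule ccontr)
  assume neg: "\<not> ?thesis"
  obtain \<phi> where \<phi>: "fv \<phi> \<subseteq> {..<d + m + n}" "\<And>e. sat M e \<phi> \<longleftrightarrow> P e"
    using P by (auto simp: definable_def)
  \<comment> \<open>The official notion has no parameters, so the \<open>m\<close> parameter
    variables join the variable of the first sequence in the first tuple. This is where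
    \<open>n \<ge> 1\<close> enters.\<close>
  define yss where "yss = [d..<d + m + 1] # map (\<lambda>k. [d + m + k]) [1..<n]"
  have cy: "concat yss = [d..<d + m + n]"
  proof -
    have "concat yss = [d..<d + m + 1] @ map (\<lambda>k. d + m + k) [1..<n]"
      unfolding yss_def by (simp del: upt_Suc add: concat_map_singleton)
    also have "map (\<lambda>k. d + m + k) [1..<n] = [d + m + 1..<d + m + n]"
      by (rule nth_equalityI) auto
    also have "[d..<d + m + 1] @ \<dots> = [d..<d + m + n]"
      using upt_add_eq_append[of d "d + m + 1" "n - 1"] n by simp
    finally show ?thesis .
  qed
  have part: "partitioned n \<phi> [0..<d] yss"
    unfolding partitioned_def cy using n \<phi>(1)
    by (auto simp: yss_def)
  have "has_IP TYPE(nat \<Rightarrow> 'a) n (Th M) \<phi> [0..<d] yss"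
  proof (rule has_IP_if_finite_patterns[OF M part])
    fix D :: nat
    have "\<exists>c a. \<forall>s. \<exists>b. \<forall>\<iota>. \<not> (length \<iota> = n \<and> set \<iota> \<subseteq> {..<D} \<and>
      \<not> (P (split_env d m b c a \<iota>) \<longleftrightarrow> \<iota> \<in> s))"
      using neg by (simp only: not_ex not_all simp_thms)
    then obtain c a where ca: "\<forall>s. \<exists>b. \<forall>\<iota>. \<not> (length \<iota> = n \<and> set \<iota> \<subseteq> {..<D} \<and>
      \<not> (P (split_env d m b c a \<iota>) \<longleftrightarrow> \<iota> \<in> s))"
      by (elim exE) (rule that)
    \<comment> \<open>Every member of the first sequence carries the same copy of the
      parameters.\<close>
    define A where "A k i = (if k = 0 then map c [d..<d + m] @ [a 0 i] else [a k i])" for k :: nat and i :: nat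
    have "\<exists>b'. length b' = length [0..<d] \<and> (\<forall>\<iota>. length \<iota> = n \<longrightarrow> set \<iota> \<subseteq> {..<D} \<longrightarrow>
       (sat M (assign ([0..<d] @ concat yss) (b' @ concat (map (\<lambda>k. A k (\<iota> ! k)) [0..<n]))) \<phi> \<longleftrightarrow> \<iota> \<in> s))" for s
    proof -
      from ca obtain b where "\<forall>\<iota>. \<not> (length \<iota> = n \<and> set \<iota> \<subseteq> {..<D} \<and>
        \<not> (P (split_env d m b c a \<iota>) \<longleftrightarrow> \<iota> \<in> s))"
        by (elim allE[of _ s] exE) (rule that)
      then have b: "\<And>\<iota>. length \<iota> = n \<Longrightarrow> set \<iota> \<subseteq> {..<D} \<Longrightarrow>
        P (split_env d m b c a \<iota>) \<longleftrightarrow> \<iota> \<in> s" by simp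
      have "sat M (assign ([0..<d] @ concat yss) (map b [0..<d] @ concat (map (\<lambda>k. A k (\<iota> ! k)) [0..<n]))) \<phi> \<longleftrightarrow> \<iota> \<in> s"
        if \<iota>: "length \<iota> = n" "set \<iota> \<subseteq> {..<D}" for \<iota>
      proof -
        have c1: "concat (map (\<lambda>k. A k (\<iota> ! k)) [0..<n]) = map c [d..<d + m] @ map (\<lambda>k. a k (\<iota> ! k)) [0..<n]"
        proof -
          have "map (\<lambda>k. A k (\<iota> ! k)) [1..<n] = map (\<lambda>k. [a k (\<iota> ! k)]) [1..<n]"
            by (simp add: A_def)
          then have "concat (map (\<lambda>k. A k (\<iota> ! k)) [1..<n]) = map (\<lambda>k. a k (\<iota> ! k)) [1..<n]"
            by (simp only: concat_map_singleton)
          moreover have "[0..<n] = 0 # [1..<n]" using n by (simp add: upt_conv_Cons)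
          moreover have "A 0 (\<iota> ! 0) = map c [d..<d + m] @ [a 0 (\<iota> ! 0)]" by (simp add: A_def)
          ultimately show ?thesis by simp
        qed
        have nth: "(map b [0..<d] @ map c [d..<d + m] @ map (\<lambda>k. a k (\<iota> ! k)) [0..<n]) ! v
          = split_env d m b c a \<iota> v" if "v < d + m + n" for v
        proof -
          consider "v < d" | "d \<le> v" "v < d + m" | "d + m \<le> v" by linarith
          then show ?thesis
          proof cases
            case 2
            then have "v - d < m" by linarith
            with 2 show ?thesis by (simp add: nth_append split_env_def)
          next
            case 3
            then have "\<not> v - d < m" "v - d - m < n" using that by linarith+
            with 3 show ?thesis by (simp add: nth_append split_env_def)
          qed (simp add: nth_append split_env_def)
        qed
        have "[0..<d] @ concat yss = [0..<d + m + n]"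
          unfolding cy using upt_add_eq_append[of 0 d "m + n"] by (simp add: add.assoc)
        then have "assign ([0..<d] @ concat yss) (map b [0..<d] @ concat (map (\<lambda>k. A k (\<iota> ! k)) [0..<n])) v
          = split_env d m b c a \<iota> v"
          if "v < d + m + n" for v
          unfolding c1 using that
            assign_nth[of "[0..<d + m + n]" "map b [0..<d] @ map c [d..<d + m] @ map (\<lambda>k. a k (\<iota> ! k)) [0..<n]" v]
          by (simp add: nth[OF that])
        then have "sat M (assign ([0..<d] @ concat yss) (map b [0..<d] @ concat (map (\<lambda>k. A k (\<iota> ! k)) [0..<n]))) \<phi>
          \<longleftrightarrow> sat M (split_env d m b c a \<iota>) \<phi>"
          using \<phi>(1) by (intro sat_cong) auto
        then show ?thesis using \<phi>(2) b[OF \<iota>] by simp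
      qed
      then show ?thesis by (intro exI[of _ "map b [0..<d]"] conjI allI impI) simp_all
    qed
    moreover have "length (A k i) = length (yss ! k)" if "k < n" for k i
      using that by (cases k) (auto simp: A_def yss_def)
    ultimately show "\<exists>a. (\<forall>k<n. \<forall>i. length (a k i) = length (yss ! k)) \<and>
      (\<forall>s. \<exists>b. length b = length [0..<d] \<and> (\<forall>\<iota>. length \<iota> = n \<longrightarrow> set \<iota> \<subseteq> {..<D} \<longrightarrow>
        (sat M (assign ([0..<d] @ concat yss) (b @ concat (map (\<lambda>k. a k (\<iota> ! k)) [0..<n]))) \<phi> \<longleftrightarrow> \<iota> \<in> s)))"
      by (intro exI[of _ A] conjI allI impI)
  qed
  then show False using dep part unfolding n_dependent_def by blast
qed

section \<open>Definable sets\<close>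

lemma definable_mono: "definable M X P \<Longrightarrow> X \<subseteq> Y \<Longrightarrow> definable M Y P"
  unfolding definable_def by blast

lemma definable_tm_Var: "v \<in> X \<Longrightarrow> definable_tm M X (\<lambda>e. e v)"
  unfolding definable_tm_def by (intro exI[of _ "Var v"]) simp

lemma definable_neg: "definable M X P \<Longrightarrow> definable M X (\<lambda>e. \<not> P e)"
  unfolding definable_def by (metis fv.simps(3) sat.simps(3))

lemma definable_conj: "definable M X P \<Longrightarrow> definable M X Q \<Longrightarrow> definable M X (\<lambda>e. P e \<and> Q e)"
  unfolding definable_def by (metis fv.simps(4) sat.simps(4) Un_least)

lemma definable_eq:
  "definable_tm M X f \<Longrightarrow> definable_tm M X g \<Longrightarrow> definable M X (\<lambda>e. f e = g e)"
  unfolding definable_def definable_tm_def by (metis fv.simps(1) sat.simps(1) Un_least)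

lemma definable_val: "definable_tm M X f \<Longrightarrow> definable M X (\<lambda>e. f e \<in> val_of M)"
  unfolding definable_def definable_tm_def by (metis fv.simps(2) sat.simps(2))

lemma definable_True: "definable M X (\<lambda>_. True)"
  unfolding definable_def by (intro exI[of _ "Eq TZero TZero"]) simp

lemma definable_ball:
  fixes d :: nat
  assumes "\<And>i. i < d \<Longrightarrow> definable M X (P i)"
  shows "definable M X (\<lambda>e. \<forall>i<d. P i e)"
  using assms
proof (induction d)
  case (Suc d)
  have "definable M X (\<lambda>e. (\<forall>i<d. P i e) \<and> P d e)"
    using Suc by (intro definable_conj) auto
  moreover have "(\<forall>i<Suc d. P i e) \<longleftrightarrow> (\<forall>i<d. P i e) \<and> P d e" for e
    by (auto simp: less_Suc_eq)
  ultimately show ?case by simp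
qed (simp add: definable_True)

lemma definable_ex:
  assumes "definable M (insert v X) P" "dom M = UNIV"
  shows "definable M X (\<lambda>e. \<exists>a. P (e(v := a)))"
proof -
  obtain \<phi> where "fv \<phi> \<subseteq> insert v X" "\<And>e. sat M e \<phi> \<longleftrightarrow> P e" using assms(1) by (auto simp: definable_def)
  then show ?thesis unfolding definable_def using assms(2) by (intro exI[of _ "Ex v \<phi>"]) auto
qed

definition shadow :: "nat \<Rightarrow> nat \<Rightarrow> (nat \<Rightarrow> 'm) \<Rightarrow> (nat \<Rightarrow> 'm) \<Rightarrow> nat \<Rightarrow> 'm" where
  "shadow L k u e v = (if L \<le> v \<and> v < L + k then u (v - L) else e v)"

text \<open>Quantifies the block of variables from \<open>L\<close> to \<open>L + k - 1\<close>; the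
  induction peels off the last one.\<close>

lemma definable_ex_tuple:
  assumes "definable M (X \<union> {L..<L + k}) P" "dom M = UNIV"
  shows "definable M X (\<lambda>e. \<exists>u. P (shadow L k u e))"
  using assms(1)
proof (induction k arbitrary: X)
  case 0
  have "shadow L 0 u e = e" for u e :: "nat \<Rightarrow> 'a" by (auto simp: shadow_def fun_eq_iff)
  then show ?case using 0 by simp
next
  case (Suc k)
  have "X \<union> {L..<L + Suc k} = insert (L + k) X \<union> {L..<L + k}" by auto
  with Suc have "definable M (insert (L + k) X) (\<lambda>e. \<exists>u. P (shadow L k u e))" by metis
  from definable_ex[OF this assms(2)]
  have "definable M X (\<lambda>e. \<exists>a u. P (shadow L k u (e(L + k := a))))" .
  moreover have "(\<exists>a u. P (shadow L k u (e(L + k := a)))) \<longleftrightarrow> (\<exists>u. P (shadow L (Suc k) u e))" for e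
  proof
    assume "\<exists>a u. P (shadow L k u (e(L + k := a)))"
    then obtain a u where "P (shadow L k u (e(L + k := a)))" by blast
    moreover have "shadow L k u (e(L + k := a)) = shadow L (Suc k) (u(k := a)) e"
      by (auto simp: shadow_def fun_eq_iff)
    ultimately show "\<exists>u. P (shadow L (Suc k) u e)" by auto
  next
    assume "\<exists>u. P (shadow L (Suc k) u e)"
    then obtain u where "P (shadow L (Suc k) u e)" by blast
    moreover have "shadow L k u (e(L + k := u k)) = shadow L (Suc k) u e"
      by (auto simp: shadow_def fun_eq_iff less_Suc_eq)
    ultimately show "\<exists>a u. P (shadow L k u (e(L + k := a)))" by metis
  qed
  ultimately show ?case by simp
qed

section \<open>Terms and definable sets in a valued field\<close>

context
  fixes \<O> :: "'a::field set"
begin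

lemma dom_valued_field: "dom (valued_field \<O>) = UNIV"
  by (simp add: valued_field_def)

lemma definable_tm_const:
  "definable_tm (valued_field \<O>) X (\<lambda>_. 0)" "definable_tm (valued_field \<O>) X (\<lambda>_. 1)"
  unfolding definable_tm_def
  by (intro exI[of _ TZero]; simp add: valued_field_def) (intro exI[of _ TOne]; simp add: valued_field_def)

lemma definable_tm_add:
  "definable_tm (valued_field \<O>) X f \<Longrightarrow> definable_tm (valued_field \<O>) X g \<Longrightarrow> definable_tm (valued_field \<O>) X (\<lambda>e. f e + g e)"
  unfolding definable_tm_def
  by (elim exE, rule_tac x = "TAdd t ta" in exI) (simp add: valued_field_def)

lemma definable_tm_mult:
  "definable_tm (valued_field \<O>) X f \<Longrightarrow> definable_tm (valued_field \<O>) X g \<Longrightarrow> definable_tm (valued_field \<O>) X (\<lambda>e. f e * g e)"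
  unfolding definable_tm_def
  by (elim exE, rule_tac x = "TMult t ta" in exI) (simp add: valued_field_def)

lemma definable_tm_uminus:
  "definable_tm (valued_field \<O>) X f \<Longrightarrow> definable_tm (valued_field \<O>) X (\<lambda>e. - f e)"
  unfolding definable_tm_def
  by (elim exE, rule_tac x = "TMinus t" in exI) (simp add: valued_field_def)

lemma definable_tm_diff:
  "definable_tm (valued_field \<O>) X f \<Longrightarrow> definable_tm (valued_field \<O>) X g \<Longrightarrow> definable_tm (valued_field \<O>) X (\<lambda>e. f e - g e)"
  using definable_tm_add[OF _ definable_tm_uminus] by fastforce

lemma definable_tm_power: "definable_tm (valued_field \<O>) X f \<Longrightarrow> definable_tm (valued_field \<O>) X (\<lambda>e. f e ^ k)"
  by (induction k) (simp_all add: definable_tm_const definable_tm_mult)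

lemma definable_tm_sum:
  "(\<And>i. i < (k :: nat) \<Longrightarrow> definable_tm (valued_field \<O>) X (f i)) \<Longrightarrow> definable_tm (valued_field \<O>) X (\<lambda>e. \<Sum>i<k. f i e)"
  by (induction k) (simp_all add: definable_tm_const definable_tm_add)

lemma definable_tm_prod:
  "(\<And>i. i < (k :: nat) \<Longrightarrow> definable_tm (valued_field \<O>) X (f i)) \<Longrightarrow> definable_tm (valued_field \<O>) X (\<lambda>e. \<Prod>i<k. f i e)"
  by (induction k) (simp_all add: definable_tm_const definable_tm_mult)

lemma definable_valuation_ring:
  "definable_tm (valued_field \<O>) X f \<Longrightarrow> definable (valued_field \<O>) X (\<lambda>e. f e \<in> \<O>)"
  using definable_val[of "valued_field \<O>" X f] by (simp add: valued_field_def)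

lemma definable_max_ideal: "definable (valued_field \<O>) {v} (\<lambda>e. e v \<in> max_ideal \<O>)"
proof -
  \<comment> \<open>\<open>Suc v\<close> serves as the bound variable for the inverse because it
    differs from \<open>v\<close>.\<close>
  have "definable (valued_field \<O>) (insert (Suc v) {v}) (\<lambda>e. e (Suc v) \<in> \<O> \<and> e v * e (Suc v) = 1)"
    by (intro definable_conj definable_valuation_ring definable_eq definable_tm_mult
        definable_tm_Var definable_tm_const) auto
  from definable_ex[OF this dom_valued_field]
  have "definable (valued_field \<O>) {v} (\<lambda>e. \<exists>b. b \<in> \<O> \<and> e v * b = 1)" by simp
  then have "definable (valued_field \<O>) {v} (\<lambda>e. e v \<in> \<O> \<and> \<not> (\<exists>b. b \<in> \<O> \<and> e v * b = 1))"
    by (intro definable_conj definable_valuation_ring definable_neg definable_tm_Var) auto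
  then show ?thesis by (simp add: max_ideal_def Bex_def)
qed

end

section \<open>Valuation rings and polynomials over them\<close>

locale val_ring =
  fixes R :: "'a::field set"
  assumes valuation_ring: "valuation_ring R"
begin

abbreviation \<mm> :: "'a set" where "\<mm> \<equiv> max_ideal R"

lemma one_in: "1 \<in> R"
  and diff_in: "x \<in> R \<Longrightarrow> y \<in> R \<Longrightarrow> x - y \<in> R"
  and mult_in: "x \<in> R \<Longrightarrow> y \<in> R \<Longrightarrow> x * y \<in> R"
  using valuation_ring unfolding valuation_ring_def by blast+

lemma zero_in: "0 \<in> R"
  using diff_in[OF one_in one_in] by simp

lemma in_or_inverse_in: "x \<in> R \<or> inverse x \<in> R"
  using valuation_ring zero_in unfolding valuation_ring_def by (cases "x = 0") auto

lemma uminus_in: "x \<in> R \<Longrightarrow> - x \<in> R"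
  using diff_in[OF zero_in] by simp

lemma add_in: "x \<in> R \<Longrightarrow> y \<in> R \<Longrightarrow> x + y \<in> R"
  using diff_in[of x "- y"] uminus_in by simp

lemma power_in: "x \<in> R \<Longrightarrow> x ^ k \<in> R"
  by (induction k) (auto intro: one_in mult_in)

lemma prod_in: "(\<And>i. i \<in> I \<Longrightarrow> f i \<in> R) \<Longrightarrow> prod f I \<in> R"
  by (induction I rule: infinite_finite_induct) (auto intro: one_in mult_in)

lemma max_idealD: "x \<in> \<mm> \<Longrightarrow> x \<in> R"
  by (simp add: max_ideal_def)

lemma zero_in_max_ideal: "0 \<in> \<mm>"
  by (simp add: max_ideal_def zero_in)

lemma one_notin_max_ideal: "1 \<notin> \<mm>"
  using one_in by (auto simp: max_ideal_def)

lemma mult_in_max_ideal: "r \<in> R \<Longrightarrow> x \<in> \<mm> \<Longrightarrow> r * x \<in> \<mm>"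
  by (auto simp: max_ideal_def mult_in mult.assoc mult.left_commute)
    (metis mult.assoc mult.commute mult_in)

lemma unit_iff: "x \<in> R - \<mm> \<longleftrightarrow> x \<noteq> 0 \<and> x \<in> R \<and> inverse x \<in> R"
proof
  assume x: "x \<in> R - \<mm>"
  then obtain b where "b \<in> R" "x * b = 1" by (auto simp: max_ideal_def)
  then show "x \<noteq> 0 \<and> x \<in> R \<and> inverse x \<in> R"
    using x by (metis DiffD1 inverse_unique mult_zero_left zero_neq_one)
next
  assume "x \<noteq> 0 \<and> x \<in> R \<and> inverse x \<in> R"
  then show "x \<in> R - \<mm>" by (auto simp: max_ideal_def intro!: bexI[of _ "inverse x"])
qed

lemma unit_nonzero: "x \<in> R - \<mm> \<Longrightarrow> x \<noteq> 0"
  and unit_inverse_in: "x \<in> R - \<mm> \<Longrightarrow> inverse x \<in> R"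
  using unit_iff by blast+

lemma divide_unit_in: "x \<in> R \<Longrightarrow> y \<in> R - \<mm> \<Longrightarrow> x / y \<in> R"
  by (simp add: divide_inverse mult_in unit_inverse_in del: Diff_iff)

lemma max_ideal_prime: "x \<in> R \<Longrightarrow> y \<in> R \<Longrightarrow> x * y \<in> \<mm> \<Longrightarrow> x \<in> \<mm> \<or> y \<in> \<mm>"
  by (metis DiffI divide_inverse mult.commute mult_in_max_ideal nonzero_mult_div_cancel_left
      unit_inverse_in unit_nonzero)

text \<open>Of two nonzero elements one divides the other in \<open>R\<close>, so the sum is an
  \<open>R\<close>-multiple of one of the summands.\<close>

lemma add_in_max_ideal:
  assumes "x \<in> \<mm>" "y \<in> \<mm>" shows "x + y \<in> \<mm>"
proof (cases "x = 0 \<or> y = 0")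
  case False
  have *: "a + b \<in> \<mm>" if "a \<noteq> 0" "a \<in> \<mm>" "b / a \<in> R" for a b
  proof -
    have "(1 + b / a) * a = a + b" using that(1) by (simp add: distrib_right)
    then show ?thesis using mult_in_max_ideal[OF add_in[OF one_in that(3)] that(2)] by metis
  qed
  from in_or_inverse_in[of "x / y"] show ?thesis
    using *[of x y] *[of y x] assms False by (auto simp: add.commute)
qed (use assms in auto)

lemma uminus_in_max_ideal: "x \<in> \<mm> \<Longrightarrow> - x \<in> \<mm>"
  using mult_in_max_ideal[OF uminus_in[OF one_in]] by fastforce

lemma diff_in_max_ideal: "x \<in> \<mm> \<Longrightarrow> y \<in> \<mm> \<Longrightarrow> x - y \<in> \<mm>"
  using add_in_max_ideal uminus_in_max_ideal by fastforce

lemma unit_cong: "x \<in> R - \<mm> \<Longrightarrow> y - x \<in> \<mm> \<Longrightarrow> y \<in> R - \<mm>"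
  using add_in[of x "y - x"] diff_in_max_ideal[of y "y - x"] max_idealD by auto

end

section \<open>Ideals and polynomials with coefficients in them\<close>

text \<open>The whole ring counts as an ideal: the two applications take \<open>V = R\<close> and
  \<open>V = \<mm>\<close>.\<close>

definition ideal_of :: "'a::comm_ring_1 set \<Rightarrow> 'a set \<Rightarrow> bool" where
  "ideal_of R V \<longleftrightarrow> V \<subseteq> R \<and> 0 \<in> V \<and> (\<forall>x\<in>V. \<forall>y\<in>V. x - y \<in> V) \<and> (\<forall>r\<in>R. \<forall>x\<in>V. r * x \<in> V)"

definition polys_over :: "'a::zero set \<Rightarrow> 'a poly set" where
  "polys_over V = {g. \<forall>i. coeff g i \<in> V}"

context
  fixes R V :: "'a::comm_ring_1 set"
  assumes ideal: "ideal_of R V"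
begin

lemma ideal_zero: "0 \<in> V"
  and ideal_diff: "x \<in> V \<Longrightarrow> y \<in> V \<Longrightarrow> x - y \<in> V"
  and ideal_mult: "r \<in> R \<Longrightarrow> x \<in> V \<Longrightarrow> r * x \<in> V"
  and ideal_subset: "x \<in> V \<Longrightarrow> x \<in> R"
  using ideal by (auto simp: ideal_of_def)

lemma ideal_add: "x \<in> V \<Longrightarrow> y \<in> V \<Longrightarrow> x + y \<in> V"
  using ideal_diff[of x "- y"] ideal_diff[OF ideal_zero, of y] by simp

lemma ideal_sum: "(\<And>i. i \<in> I \<Longrightarrow> f i \<in> V) \<Longrightarrow> sum f I \<in> V"
  by (induction I rule: infinite_finite_induct) (auto intro: ideal_zero ideal_add)

lemma polys_over_zero: "0 \<in> polys_over V"
  and polys_over_diff: "g \<in> polys_over V \<Longrightarrow> k \<in> polys_over V \<Longrightarrow> g - k \<in> polys_over V"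
  and polys_over_add: "g \<in> polys_over V \<Longrightarrow> k \<in> polys_over V \<Longrightarrow> g + k \<in> polys_over V"
  by (auto simp: polys_over_def ideal_zero ideal_diff ideal_add)

lemma polys_over_uminus: "g \<in> polys_over V \<Longrightarrow> - g \<in> polys_over V"
  using polys_over_diff[OF polys_over_zero] by fastforce

lemma polys_over_mono: "g \<in> polys_over V \<Longrightarrow> g \<in> polys_over R"
  by (auto simp: polys_over_def ideal_subset)

lemma polys_over_mult: "g \<in> polys_over R \<Longrightarrow> k \<in> polys_over V \<Longrightarrow> g * k \<in> polys_over V"
  by (auto simp: polys_over_def coeff_mult intro!: ideal_sum ideal_mult)

lemma polys_over_smult: "r \<in> R \<Longrightarrow> g \<in> polys_over V \<Longrightarrow> smult r g \<in> polys_over V"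
  by (auto simp: polys_over_def intro: ideal_mult)

lemma polys_over_sum: "(\<And>i. i \<in> I \<Longrightarrow> f i \<in> polys_over V) \<Longrightarrow> sum f I \<in> polys_over V"
  by (auto simp: polys_over_def coeff_sum intro: ideal_sum)

lemma polys_over_power: "k > 0 \<Longrightarrow> g \<in> polys_over V \<Longrightarrow> g ^ k \<in> polys_over V"
  by (induction k rule: nat_induct_non_zero) (auto intro: polys_over_mult polys_over_mono)

lemma polys_over_monom: "x \<in> V \<Longrightarrow> monom x k \<in> polys_over V"
  by (auto simp: polys_over_def ideal_zero)

lemma polys_over_poly: "g \<in> polys_over V \<Longrightarrow> x \<in> R \<Longrightarrow> poly g x \<in> V"
proof (induction g)
  case (pCons a g)
  have "a \<in> V" "g \<in> polys_over V"
    using pCons.prems(1) by (auto simp: polys_over_def coeff_pCons split: nat.splits dest: spec[of _ 0] spec[of _ "Suc _"])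
  then show ?case using pCons by (simp add: ideal_add ideal_mult)
qed (simp add: ideal_zero)

end

text \<open>Long division by a monic polynomial never divides by a coefficient, so each step stays
  inside \<open>V\<close>.\<close>

lemma polys_over_div_mod:
  fixes h :: "'a::field poly"
  assumes "ideal_of R V" "h \<in> polys_over R" "lead_coeff h = 1" "g \<in> polys_over V"
  shows "g div h \<in> polys_over V \<and> g mod h \<in> polys_over V"
  using assms(4)
\<comment> \<open>The length of the coefficient list, unlike the degree, separates the zero
  polynomial from nonzero constants.\<close>
proof (induction "length (coeffs g)" arbitrary: g rule: less_induct)
  case less
  have h: "h \<noteq> 0" using assms(3) by auto
  show ?case
  proof (cases "g = 0 \<or> degree g < degree h")
    case True
    then show ?thesis using less.prems polys_over_zero[OF assms(1)]
      by (auto simp: div_poly_less mod_poly_less)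
  next
    case False
    define q where "q = monom (lead_coeff g) (degree g - degree h)"
    have q: "q \<in> polys_over V"
      unfolding q_def using less.prems by (intro polys_over_monom[OF assms(1)]) (auto simp: polys_over_def)
    define g' where "g' = g - q * h"
    have g': "g' \<in> polys_over V" unfolding g'_def
      using polys_over_diff[OF assms(1) less.prems polys_over_mult[OF assms(1) assms(2) q]]
      by (simp add: mult.commute)
    have lc: "lead_coeff (q * h) = lead_coeff g" using assms(3) False
      by (simp add: lead_coeff_mult q_def degree_monom_eq)
    have dg: "degree (q * h) = degree g" using False h
      by (simp add: q_def degree_mult_eq degree_monom_eq)
    have "length (coeffs g') < length (coeffs g)"
    proof (cases "g' = 0")
      case True then show ?thesis using False by simp
    next
      case g'0: False
      have "degree g' \<le> degree g" using dg by (simp add: g'_def degree_diff_le)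
      moreover have "coeff g' (degree g) = 0" using lc dg by (simp add: g'_def)
      ultimately have "degree g' < degree g"
        using g'0 by (metis le_neq_implies_less leading_coeff_0_iff)
      then show ?thesis using g'0 False by (simp add: length_coeffs_degree)
    qed
    from less.hyps[OF this g'] have "g' div h \<in> polys_over V" "g' mod h \<in> polys_over V" by auto
    moreover have "g = g' + q * h" by (simp add: g'_def)
    then have "g div h = q + g' div h" "g mod h = g' mod h" using h by simp_all
    ultimately show ?thesis using polys_over_add[OF assms(1) q] by simp
  qed
qed

lemmas polys_over_mod = polys_over_div_mod[THEN conjunct2]

section \<open>Residue classes and roots modulo the maximal ideal\<close>

context val_ring
begin

lemma ideal_of_self: "ideal_of R R"
  by (auto simp: ideal_of_def zero_in diff_in mult_in)

lemma ideal_of_max_ideal: "ideal_of R \<mm>"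
  by (auto simp: ideal_of_def zero_in_max_ideal diff_in_max_ideal mult_in_max_ideal max_idealD)

text \<open>The coset of \<open>x\<close>. The residue field is used only as the set of these
  cosets, to speak of its being infinite.\<close>

definition residue_class :: "'a \<Rightarrow> 'a set" where
  "residue_class x = {y \<in> R. y - x \<in> \<mm>}"

lemma residue_class_eq_iff: "x \<in> R \<Longrightarrow> y \<in> R \<Longrightarrow> residue_class x = residue_class y \<longleftrightarrow> x - y \<in> \<mm>"
proof -
  assume xy: "x \<in> R" "y \<in> R"
  have *: "z - y \<in> \<mm>" if "x - y \<in> \<mm>" "z - x \<in> \<mm>" for x y z
    using add_in_max_ideal[OF that] by simp
  show ?thesis
  proof
    assume "residue_class x = residue_class y"
    moreover have "x \<in> residue_class x" using xy by (simp add: residue_class_def zero_in_max_ideal)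
    ultimately show "x - y \<in> \<mm>" by (simp add: residue_class_def)
  next
    assume "x - y \<in> \<mm>"
    moreover from this have "y - x \<in> \<mm>" using uminus_in_max_ideal by fastforce
    ultimately show "residue_class x = residue_class y"
      unfolding residue_class_def using * by blast
  qed
qed

text \<open>A monic polynomial has finitely many roots in the residue field. The usual induction is
  carried out over \<open>R\<close>, splitting off a linear factor at a root modulo
  \<open>\<mm>\<close>.\<close>

lemma finite_residue_roots:
  assumes "g \<in> polys_over R" "lead_coeff g = 1"
  shows "finite (residue_class ` {t \<in> R. poly g t \<in> \<mm>})"
  using assms
proof (induction "degree g" arbitrary: g)
  case 0
  then have "g = 1" by (metis degree_eq_zeroE lead_coeff_pCons(2) one_pCons)
  then show ?case using one_notin_max_ideal by simp
next
  case (Suc k)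
  show ?case
  proof (cases "\<exists>t\<in>R. poly g t \<in> \<mm>")
    case True
    then obtain t where t: "t \<in> R" "poly g t \<in> \<mm>" by blast
    define q where "q = synthetic_div g t"
    \<comment> \<open>The remainder \<open>poly g t\<close> lies in \<open>\<mm>\<close> but may be
      nonzero; differences \<open>poly g x - poly g t\<close> remove it below.\<close>
    have q: "g = [:-t, 1:] * q + [:poly g t:]"
      unfolding q_def by (rule synthetic_div_correct'[symmetric])
    have "[:poly g t:] div [:-t, 1:] = 0" by (rule div_poly_less) simp
    then have "g div [:-t, 1:] = q"
      by (subst q) (simp del: mult_pCons_left)
    then have "q \<in> polys_over R"
      using t Suc.prems polys_over_div_mod[OF ideal_of_self, of "[:-t, 1:]" g]
      by (auto simp: polys_over_def coeff_pCons one_in uminus_in zero_in split: nat.splits)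
    moreover have "degree q = k"
      unfolding q_def degree_synthetic_div using Suc.hyps(2) by simp
    moreover have "lead_coeff q = 1"
    proof -
      have "q \<noteq> 0" unfolding q_def synthetic_div_eq_0_iff using Suc.hyps(2) by simp
      then have "degree [:poly g t:] < degree ([:-t, 1:] * q)" by (subst degree_mult_eq) auto
      from lead_coeff_add_le[OF this] have "lead_coeff g = lead_coeff ([:-t, 1:] * q)"
        using q by (simp only: add.commute[of "[:poly g t:]"] q[symmetric])
      then show ?thesis using Suc.prems(2) by (simp only: lead_coeff_mult) simp
    qed
    ultimately have IH: "finite (residue_class ` {t \<in> R. poly q t \<in> \<mm>})"
      using Suc.hyps(1) by blast
    have "residue_class ` {t \<in> R. poly g t \<in> \<mm>} \<subseteq>
      insert (residue_class t) (residue_class ` {t \<in> R. poly q t \<in> \<mm>})"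
    proof (rule image_subsetI)
      fix x assume "x \<in> {t \<in> R. poly g t \<in> \<mm>}"
      then have x: "x \<in> R" "poly g x - poly g t \<in> \<mm>" using t diff_in_max_ideal by auto
      have "poly g x - poly g t = poly q x * (x - t)"
        by (subst q, simp add: algebra_simps)
      with x have "poly q x \<in> \<mm> \<or> x - t \<in> \<mm>"
        using max_ideal_prime[of "poly q x" "x - t"] t diff_in polys_over_poly[OF ideal_of_self] \<open>q \<in> polys_over R\<close>
        by simp
      then show "residue_class x \<in> insert (residue_class t) (residue_class ` {t \<in> R. poly q t \<in> \<mm>})"
        using x t residue_class_eq_iff by auto
    qed
    then show ?thesis using IH by (meson finite_insert finite_subset)
  next
    case False
    then have "{t \<in> R. poly g t \<in> \<mm>} = {}" by blast
    then show ?thesis by (simp only: image_empty finite.emptyI)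
  qed
qed

lemma ex_unit_value:
  assumes "infinite (residue_class ` R)" "g \<in> polys_over R" "lead_coeff g = 1"
  shows "\<exists>t\<in>R. poly g t \<in> R - \<mm>"
proof (rule ccontr)
  assume "\<not> ?thesis"
  then have "R \<subseteq> {t \<in> R. poly g t \<in> \<mm>}"
    using polys_over_poly[OF ideal_of_self assms(2)] by blast
  then show False using finite_residue_roots[OF assms(2,3)] assms(1)
    by (meson finite_subset image_mono)
qed

end

section \<open>Additive interpolation\<close>

text \<open>In characteristic \<open>p\<close> this is \<open>P\<^sub>j(t^i)\<close> for the
  additive polynomial \<open>P\<^sub>j\<close> built to vanish at \<open>1, t, ..., t^(j-1)\<close>.
  The recursion is the product of \<open>P\<^sub>j - c P\<^sub>j(t^j)\<close> over \<open>c\<close>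
  in the prime field.\<close>

primrec moore :: "nat \<Rightarrow> 'a::comm_ring_1 \<Rightarrow> nat \<Rightarrow> nat \<Rightarrow> 'a" where
  "moore p t 0 = (\<lambda>i. t ^ i)"
| "moore p t (Suc j) = (\<lambda>i. moore p t j i ^ p - moore p t j j ^ (p - 1) * moore p t j i)"

text \<open>Allows the values to be read as polynomials in \<open>t\<close>, to which root counting
  applies.\<close>

lemma poly_moore: "poly (moore p [:0, 1:] j i) t = moore p t j i"
  by (induction j arbitrary: i) (simp_all add: poly_power)

lemma moore_eq_0:
  assumes "p > 0" "i < j" shows "moore p t j i = 0"
  using assms(2)
proof (induction j)
  case (Suc j)
  show ?case
  proof (cases "i = j")
    case True
    have "moore p t j j ^ p = moore p t j j ^ (p - 1) * moore p t j j"
      using power_minus_mult[OF assms(1)] by metis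
    with True show ?thesis by simp
  qed (use Suc assms(1) in \<open>simp add: power_0_left\<close>)
qed simp

text \<open>For \<open>j < i\<close> the \<open>p\<close>-th power dominates the correction term:
  \<open>p * i * p^j\<close> exceeds \<open>(p - 1) * j * p^j + i * p^j\<close>. The diagonal values
  are thus monic polynomials in \<open>t\<close>.\<close>

lemma moore_monic:
  fixes X :: "'a::field poly"
  assumes "p > 1" "j \<le> i" and X: "X = [:0, 1:]"
  shows "degree (moore p X j i) = i * p ^ j \<and> lead_coeff (moore p X j i) = 1"
  using assms(2)
proof (induction j arbitrary: i)
  case 0
  then show ?case by (simp add: X degree_power_eq) (metis X monom_altdef coeff_monom smult_1_left)
next
  case (Suc j)
  define A where "A = moore p X j i ^ p"
  define B where "B = - (moore p X j j ^ (p - 1) * moore p X j i)"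
  have i: "degree (moore p X j i) = i * p ^ j" "lead_coeff (moore p X j i) = 1"
    and j: "degree (moore p X j j) = j * p ^ j" "lead_coeff (moore p X j j) = 1"
    using Suc.IH[of i] Suc.IH[of j] Suc.prems by auto
  have A: "degree A = p * (i * p ^ j)" "lead_coeff A = 1"
  proof -
    have "moore p X j i \<noteq> 0" using i(2) by auto
    then show "degree A = p * (i * p ^ j)" "lead_coeff A = 1"
      unfolding A_def lead_coeff_power using i by (simp_all add: degree_power_eq)
  qed
  have "degree B \<le> degree (moore p X j j ^ (p - 1)) + degree (moore p X j i)"
    unfolding B_def degree_minus by (rule degree_mult_le)
  also have "\<dots> \<le> (p - 1) * (j * p ^ j) + i * p ^ j"
    using degree_power_le[of "moore p X j j" "p - 1"] i j by (simp add: mult.commute)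
  also have "\<dots> < (p - 1) * (i * p ^ j) + i * p ^ j"
    using Suc.prems assms(1) by simp
  also have "\<dots> = degree A"
    using assms(1) by (simp add: A(1) algebra_simps)
  finally have "degree B < degree A" .
  then have "degree (B + A) = degree A \<and> lead_coeff (B + A) = lead_coeff A"
    using degree_add_eq_right lead_coeff_add_le by blast
  moreover have "moore p X (Suc j) i = B + A" by (simp add: A_def B_def)
  ultimately have "degree (moore p X (Suc j) i) = p * (i * p ^ j) \<and> lead_coeff (moore p X (Suc j) i) = 1"
    using A by metis
  then show ?case by (metis power_Suc mult.left_commute)
qed

context val_ring
begin

lemma moore_in: "t \<in> R \<Longrightarrow> moore p t j i \<in> R"
  by (induction j arbitrary: i) (auto intro!: power_in diff_in mult_in)

lemma moore_polys_over: "moore p [:0, 1:] j i \<in> polys_over R"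
proof (induction j arbitrary: i)
  case 0
  have "[:0, 1:] ^ i = monom (1 :: 'a) i" by (simp add: monom_altdef)
  then show ?case using polys_over_monom[OF ideal_of_self one_in] by simp
next
  case (Suc j)
  have *: "g ^ k \<in> polys_over R" if "g \<in> polys_over R" for g k
    using that polys_over_power[OF ideal_of_self, of k g] polys_over_monom[OF ideal_of_self one_in, of 0]
    by (cases k) auto
  show ?case
    by (simp add: polys_over_diff[OF ideal_of_self] polys_over_mult[OF ideal_of_self] * Suc)
qed

text \<open>Additivity of Frobenius: raising to the power \<open>p\<close> shifts the coefficients
  by one place and keeps them in \<open>R\<close>. The coefficients do not depend on the node index
  \<open>i\<close>.\<close>

lemma moore_additive:
  assumes p: "prime p" "CHAR('a) = p" and t: "t \<in> R"
  shows "\<exists>f. (\<forall>l. f l \<in> R) \<and> (\<forall>i. moore p t j i = (\<Sum>l\<le>j. f l * t ^ (i * p ^ l)))"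
proof (induction j)
  case 0
  show ?case by (rule exI[of _ "\<lambda>_. 1"]) (simp add: one_in)
next
  case (Suc j)
  then obtain f where f: "\<And>l. f l \<in> R" "\<And>i. moore p t j i = (\<Sum>l\<le>j. f l * t ^ (i * p ^ l))"
    by blast
  define c where "c = moore p t j j ^ (p - 1)"
  \<comment> \<open>Coefficients of the \<open>p\<close>-th power are shifted up, with
    \<open>0\<close> in place \<open>0\<close>; the guard \<open>l \<le> j\<close> drops the values
    of \<open>f\<close> beyond the degree, about which nothing is known.\<close>
  define f' where "f' l = (case l of 0 \<Rightarrow> 0 | Suc k \<Rightarrow> f k ^ p) - c * (if l \<le> j then f l else 0)" for l
  have "f' l \<in> R" for l
    using f(1) moore_in[OF t] unfolding f'_def c_def
    by (auto intro!: diff_in uminus_in mult_in power_in zero_in split: nat.split)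
  moreover have "moore p t (Suc j) i = (\<Sum>l\<le>Suc j. f' l * t ^ (i * p ^ l))" for i
  proof -
    have "moore p t j i ^ p = (\<Sum>l\<le>j. f l ^ p * t ^ (i * p ^ Suc l))"
    proof -
      have "moore p t j i ^ p = (\<Sum>l\<le>j. (f l * t ^ (i * p ^ l)) ^ p)"
        unfolding f(2) using p by (intro freshmans_dream_sum) auto
      then show ?thesis by (simp add: power_mult_distrib power_mult[symmetric] mult_ac)
    qed
    also have "\<dots> = (\<Sum>l\<le>Suc j. (case l of 0 \<Rightarrow> 0 | Suc k \<Rightarrow> f k ^ p) * t ^ (i * p ^ l))"
      by (simp only: sum.atMost_Suc_shift) simp
    finally have 1: "moore p t j i ^ p = \<dots>" .
    have "c * moore p t j i = (\<Sum>l\<le>Suc j. c * (if l \<le> j then f l else 0) * t ^ (i * p ^ l))"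
      unfolding f(2) by (simp add: sum_distrib_left mult.assoc)
    with 1 show ?thesis by (simp add: c_def f'_def sum_subtractf left_diff_distrib del: sum.atMost_Suc)
  qed
  ultimately show ?case by blast
qed

text \<open>Newton interpolation with additive polynomials: the value at a new node is corrected by
  a multiple of the Moore polynomial that vanishes at all earlier nodes. The unit hypothesis keeps
  the multiplier in \<open>R\<close>.\<close>

lemma additive_interpolation:
  assumes p: "prime p" "CHAR('a) = p" and t: "t \<in> R"
    and unit: "\<And>j. j < N \<Longrightarrow> moore p t j j \<in> R - \<mm>"
    and g: "\<And>j. g j \<in> R"
  shows "\<exists>f. (\<forall>l. f l \<in> R) \<and> (\<forall>j<N. (\<Sum>l<N. f l * t ^ (j * p ^ l)) = g j)"
  using unit
proof (induction N)
  case 0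
  show ?case using zero_in by (intro exI[of _ "\<lambda>_. 0"]) simp
next
  case (Suc N)
  then obtain f where f: "\<And>l. f l \<in> R" "\<And>j. j < N \<Longrightarrow> (\<Sum>l<N. f l * t ^ (j * p ^ l)) = g j"
    by (metis less_SucI)
  obtain w where w: "\<And>l. w l \<in> R" "\<And>i. moore p t N i = (\<Sum>l\<le>N. w l * t ^ (i * p ^ l))"
    using moore_additive[OF p t] by blast
  \<comment> \<open>The error at the new node \<open>t^N\<close>, divided by the value there of the
    polynomial that is added.\<close>
  define c where "c = (g N - (\<Sum>l<N. f l * t ^ (N * p ^ l))) / moore p t N N"
  have u: "moore p t N N \<in> R - \<mm>" using Suc.prems by blast
  have "c \<in> R"
    unfolding c_def using f(1) t g
    by (intro divide_unit_in u diff_in ideal_sum[OF ideal_of_self] mult_in power_in) auto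
  define f' where "f' l = (if l < N then f l else 0) + c * w l" for l
  have "f' l \<in> R" for l
    using f(1) w(1) \<open>c \<in> R\<close> unfolding f'_def by (auto intro!: add_in mult_in zero_in)
  moreover have "(\<Sum>l<Suc N. f' l * t ^ (j * p ^ l)) = g j" if "j < Suc N" for j
  proof -
    have "(\<Sum>l<Suc N. f' l * t ^ (j * p ^ l))
        = (\<Sum>l<N. f l * t ^ (j * p ^ l)) + c * moore p t N j"
      unfolding f'_def w(2) lessThan_Suc_atMost[symmetric]
      by (simp add: distrib_right sum.distrib sum_distrib_left mult.assoc distrib_left)
    moreover have "c * moore p t N N = g N - (\<Sum>l<N. f l * t ^ (N * p ^ l))"
      using unit_nonzero[OF u] by (simp add: c_def)
    moreover have "moore p t N j = 0" if "j < N"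
      using moore_eq_0[OF prime_gt_0_nat[OF p(1)] that] .
    ultimately show ?thesis using f(2) that by (cases "j = N") auto
  qed
  ultimately show ?case by blast
qed

text \<open>The product of the diagonal Moore polynomials is monic, so it takes a unit value
  somewhere over an infinite residue field; then each factor is a unit.\<close>

lemma ex_interpolation_node:
  assumes p: "prime p" and inf: "infinite (residue_class ` R)"
  shows "\<exists>t\<in>R. \<forall>j<N. moore p t j j \<in> R - \<mm>"
proof -
  define g where "g = (\<Prod>j<N. moore p [:0, 1 :: 'a:] j j)"
  have "g \<in> polys_over R" unfolding g_def
  proof (induction N)
    case 0
    then show ?case using polys_over_monom[OF ideal_of_self one_in, of 0] by simp
  qed (simp add: polys_over_mult[OF ideal_of_self] moore_polys_over)
  moreover have "lead_coeff g = 1"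
    unfolding g_def lead_coeff_prod
    using moore_monic[OF prime_gt_1_nat[OF p] order_refl refl] by (intro prod.neutral) blast
  ultimately obtain t where t: "t \<in> R" "poly g t \<in> R - \<mm>" using ex_unit_value[OF inf] by blast
  have "poly g t = (\<Prod>j<N. moore p t j j)" by (simp add: g_def poly_prod poly_moore)
  moreover have "moore p t j j \<in> R - \<mm>" if "j < N" for j
  proof (rule ccontr)
    assume "\<not> ?thesis"
    then have "moore p t j j \<in> \<mm>" using moore_in[OF t(1)] by blast
    then have "(\<Prod>i\<in>{..<N} - {j}. moore p t i i) * moore p t j j \<in> \<mm>" (is "?x \<in> _")
    proof (rule mult_in_max_ideal[rotated])
      show "(\<Prod>i\<in>{..<N} - {j}. moore p t i i) \<in> R"
        by (rule prod_in) (rule moore_in[OF t(1)])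
    qed
    also have "?x = (\<Prod>i<N. moore p t i i)" using that by (simp add: prod.remove[of _ j] mult.commute)
    finally show False using t(2) \<open>poly g t = _\<close> by simp
  qed
  ultimately show ?thesis using t(1) by blast
qed

end

section \<open>The Artin-Schreier map on residue polynomials\<close>

lemma CHAR_poly_eq: "CHAR('a::comm_ring_1 poly) = CHAR('a)"
  by (rule CHAR_eqI) (simp_all add: of_nat_poly of_nat_eq_0_iff_char_dvd)

lemma sum_mod_poly: "sum f I mod h = (\<Sum>i\<in>I. f i mod h)" for h :: "'a::field poly"
  by (induction I rule: infinite_finite_induct) (simp_all add: poly_mod_add_left)

lemma smult_sum_right: "smult c (sum f I) = (\<Sum>i\<in>I. smult c (f i))"
  by (induction I rule: infinite_finite_induct) (simp_all add: smult_add_right)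

definition reduced_polys :: "'a::field set \<Rightarrow> 'a poly \<Rightarrow> 'a poly set" where
  "reduced_polys V h = {u \<in> polys_over V. degree u < degree h}"

text \<open>The image of \<open>w \<mapsto> w^p - w\<close> on \<open>V[X]/h\<close>, with classes
  represented by remainders modulo \<open>h\<close>.\<close>

definition artin_schreier :: "'a::field set \<Rightarrow> 'a poly \<Rightarrow> 'a poly set" where
  "artin_schreier V h = {(w ^ CHAR('a) - w) mod h |w. w \<in> reduced_polys V h}"

text \<open>Additivity of Frobenius gives each coordinate of the image as an explicit polynomial in
  the coordinates of \<open>w\<close>. The coefficients of \<open>X^(i p) mod h\<close> will be the
  parameters of a formula.\<close>

lemma coeff_artin_schreier:
  fixes h :: "'a::field poly"
  assumes p: "prime p" "CHAR('a) = p" and w: "degree w < degree h"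
  shows "coeff ((w ^ p - w) mod h) j
    = (\<Sum>i<degree h. coeff (monom 1 (i * p) mod h) j * coeff w i ^ p) - coeff w j"
proof -
  have "w = (\<Sum>i\<le>degree h - 1. monom (coeff w i) i)"
    using w by (subst poly_as_sum_of_monoms') auto
  also have "{..degree h - 1} = {..<degree h}" using w by auto
  finally have "w ^ p = (\<Sum>i<degree h. monom (coeff w i) i) ^ p" by metis
  also have "\<dots> = (\<Sum>i<degree h. monom (coeff w i) i ^ p)"
    using p by (intro freshmans_dream_sum) (auto simp: CHAR_poly_eq)
  also have "\<dots> = (\<Sum>i<degree h. smult (coeff w i ^ p) (monom 1 (i * p)))"
    by (simp add: monom_power smult_monom)
  finally have "w ^ p mod h = (\<Sum>i<degree h. smult (coeff w i ^ p) (monom 1 (i * p) mod h))"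
    by (simp only: sum_mod_poly mod_smult_left)
  then show ?thesis
    using w by (simp add: poly_mod_diff_left mod_poly_less coeff_sum mult.commute)
qed

section \<open>The Artin-Schreier image as a subgroup, its patterns and its definability\<close>

context val_ring
begin

context
  fixes V :: "'a set" and h :: "'a poly" and p :: nat
  assumes p: "prime p" "CHAR('a) = p"
    and V: "ideal_of R V" and h: "h \<in> polys_over R" "lead_coeff h = 1" "degree h > 0"
begin

lemma h_nonzero: "h \<noteq> 0"
  using h(3) by auto

lemma mod_reduced: "u \<in> polys_over V \<Longrightarrow> u mod h \<in> reduced_polys V h"
proof -
  assume "u \<in> polys_over V"
  then have "u mod h \<in> polys_over V" by (rule polys_over_mod[OF V h(1,2)])
  moreover have "degree (u mod h) < degree h"
    using degree_mod_less[OF h_nonzero, of u] h(3) by fastforce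
  ultimately show ?thesis by (simp add: reduced_polys_def)
qed

lemma artin_schreierI: "w \<in> polys_over V \<Longrightarrow> (w ^ p - w) mod h \<in> artin_schreier V h"
proof -
  assume w: "w \<in> polys_over V"
  have "(w ^ p - w) mod h = ((w mod h) ^ p - w mod h) mod h"
    by (simp add: poly_mod_diff_left power_mod)
  then show ?thesis unfolding artin_schreier_def p(2) using mod_reduced[OF w] by blast
qed

lemma artin_schreier_iff: "x \<in> artin_schreier V h \<longleftrightarrow> (\<exists>w\<in>reduced_polys V h. x = (w ^ p - w) mod h)"
  unfolding artin_schreier_def p(2) by blast

lemma artin_schreier_zero: "0 \<in> artin_schreier V h"
  using artin_schreierI[OF polys_over_zero[OF V]] prime_gt_0_nat[OF p(1)] by (simp add: power_0_left)

lemma artin_schreier_diff: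
  assumes "x \<in> artin_schreier V h" "y \<in> artin_schreier V h" shows "x - y \<in> artin_schreier V h"
proof -
  from assms(1) obtain v where "v \<in> reduced_polys V h" and vx: "x = (v ^ p - v) mod h"
    unfolding artin_schreier_iff by (rule bexE)
  then have v: "v \<in> polys_over V" by (simp add: reduced_polys_def)
  from assms(2) obtain w where "w \<in> reduced_polys V h" and wy: "y = (w ^ p - w) mod h"
    unfolding artin_schreier_iff by (rule bexE)
  then have w: "w \<in> polys_over V" by (simp add: reduced_polys_def)
  have "v ^ p = (v - w) ^ p + w ^ p"
  proof -
    have "prime CHAR('a poly)" "p = CHAR('a poly)" by (simp_all only: CHAR_poly_eq p)
    from freshmans_dream[OF this, of "v - w" w] show ?thesis by (simp only: diff_add_cancel)
  qed
  then have "x - y = ((v - w) ^ p - (v - w)) mod h"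
    unfolding vx wy by (simp add: poly_mod_diff_left poly_mod_add_left)
  then show ?thesis using artin_schreierI[OF polys_over_diff[OF V v w]] by simp
qed

lemma artin_schreier_add: "x \<in> artin_schreier V h \<Longrightarrow> y \<in> artin_schreier V h \<Longrightarrow> x + y \<in> artin_schreier V h"
  using artin_schreier_diff[of x "0 - y"] artin_schreier_diff[OF artin_schreier_zero, of y] by simp

lemma artin_schreier_sum: "(\<And>i. i \<in> I \<Longrightarrow> f i \<in> artin_schreier V h) \<Longrightarrow> sum f I \<in> artin_schreier V h"
  by (induction I rule: infinite_finite_induct) (auto intro: artin_schreier_zero artin_schreier_add)

text \<open>Telescoping: with \<open>v = u^(p^k)\<close>, the next difference is
  \<open>(v^p - v) + (v - u)\<close>.\<close>

lemma frobenius_artin_schreier: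
  assumes "u \<in> polys_over V" shows "(u ^ (p ^ k) - u) mod h \<in> artin_schreier V h"
proof (induction k)
  case (Suc k)
  have "u ^ (p ^ k) \<in> polys_over V"
    using polys_over_power[OF V _ assms, of "p ^ k"] p by (simp add: prime_gt_0_nat)
  from artin_schreier_add[OF artin_schreierI[OF this] Suc] show ?case
    by (simp add: poly_mod_add_left[symmetric] power_mult[symmetric] mult.commute)
qed (simp add: artin_schreier_zero)

text \<open>Multiplication by \<open>t^(j p^N)\<close> makes the \<open>l\<close>-th summand of
  \<open>x\<close> a \<open>p^(N-l)\<close>-th power. Modulo the image the power may be dropped,
  which leaves \<open>s\<close> times the value of an additive polynomial at
  \<open>t^j\<close>.\<close>

lemma artin_schreier_pattern:
  assumes s: "s \<in> reduced_polys V h" "s \<notin> artin_schreier V h"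
    and t: "t \<in> R" "\<And>j. j < N \<Longrightarrow> moore p t j j \<in> R - \<mm>"
  shows "\<exists>x \<in> reduced_polys V h. \<forall>j<N. smult (t ^ (j * p ^ N)) x \<in> artin_schreier V h \<longleftrightarrow> g j"
proof -
  \<comment> \<open>The value \<open>0\<close> puts the product into the image, while
    \<open>1\<close> leaves it congruent to \<open>s\<close>, which lies outside.\<close>
  obtain f where f: "\<And>l. f l \<in> R"
    "\<And>j. j < N \<Longrightarrow> (\<Sum>l<N. f l * t ^ (j * p ^ l)) = (if g j then 0 else 1)"
  proof -
    have "(if g j then 0 else 1) \<in> R" for j using zero_in one_in by simp
    with additive_interpolation[where g = "\<lambda>j. if g j then 0 else 1" and N = N, OF p t]
    show ?thesis using that by blast
  qed
  define x where "x = (\<Sum>l<N. smult (f l ^ (p ^ (N - l))) (s ^ (p ^ (N - l)))) mod h"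
  have sV: "s \<in> polys_over V" and sd: "degree s < degree h" using s by (auto simp: reduced_polys_def)
  have "x \<in> reduced_polys V h"
    unfolding x_def
    by (intro mod_reduced polys_over_sum[OF V] polys_over_smult[OF V] power_in f polys_over_power[OF V] sV)
      (use p in \<open>auto simp: prime_gt_0_nat\<close>)
  moreover have "smult (t ^ (j * p ^ N)) x \<in> artin_schreier V h \<longleftrightarrow> g j" if j: "j < N" for j
  proof -
    define v where "v l = smult (f l * t ^ (j * p ^ l)) s" for l
    have v: "v l \<in> polys_over V" for l
      unfolding v_def by (intro polys_over_smult[OF V] mult_in f power_in t sV)
    have "smult (t ^ (j * p ^ N)) (smult (f l ^ (p ^ (N - l))) (s ^ (p ^ (N - l)))) = v l ^ (p ^ (N - l))"
      if "l < N" for l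
    proof -
      \<comment> \<open>The factor \<open>t^(j p^N)\<close> is the \<open>p^(N-l)\<close>-th power
        of \<open>t^(j p^l)\<close>.\<close>
      have "p ^ N = p ^ l * p ^ (N - l)" using that by (simp add: power_add[symmetric])
      then show ?thesis
        by (simp add: v_def smult_power power_mult_distrib power_mult[symmetric] mult_ac)
    qed
    then have "smult (t ^ (j * p ^ N)) x = (\<Sum>l<N. v l ^ (p ^ (N - l))) mod h"
      unfolding x_def mod_smult_left[symmetric] by (simp add: smult_sum_right)
    moreover have "smult (if g j then 0 else 1) s = (\<Sum>l<N. v l) mod h"
      unfolding f(2)[OF j, symmetric] v_def using sd
      by (simp add: smult_sum[symmetric] mod_smult_left mod_poly_less)
    ultimately have "smult (t ^ (j * p ^ N)) x - smult (if g j then 0 else 1) s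
        = (\<Sum>l<N. (v l ^ (p ^ (N - l)) - v l) mod h)"
      by (simp add: poly_mod_diff_left[symmetric] sum_mod_poly[symmetric] sum_subtractf)
    then have *: "smult (t ^ (j * p ^ N)) x - smult (if g j then 0 else 1) s \<in> artin_schreier V h"
      by (simp only:) (intro artin_schreier_sum frobenius_artin_schreier v)
    show ?thesis
    proof (cases "g j")
      case False
      have "s = smult (t ^ (j * p ^ N)) x - (smult (t ^ (j * p ^ N)) x - s)" by simp
      then have "smult (t ^ (j * p ^ N)) x \<notin> artin_schreier V h" using * False s(2) artin_schreier_diff by (metis smult_1_left)
      then show ?thesis using False by simp
    qed (use * in simp)
  qed
  ultimately show ?thesis by blast
qed

text \<open>Membership in coordinates: a quantifier over polynomials becomes one over
  \<open>degree h\<close> field elements, hence first-order.\<close>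

lemma smult_in_artin_schreier_iff:
  assumes x: "degree x < degree h"
  shows "smult c x \<in> artin_schreier V h \<longleftrightarrow> (\<exists>u. (\<forall>i<degree h. u i \<in> V) \<and> (\<forall>j<degree h.
    c * coeff x j = (\<Sum>i<degree h. coeff (monom 1 (i * p) mod h) j * u i ^ p) - u j))"
    (is "_ \<longleftrightarrow> (\<exists>u. ?P u)")
proof
  assume "smult c x \<in> artin_schreier V h"
  then obtain w where w: "w \<in> reduced_polys V h" "smult c x = (w ^ p - w) mod h"
    unfolding artin_schreier_iff by blast
  have "?P (coeff w)"
    using w coeff_artin_schreier[OF p, of w h] by (auto simp: reduced_polys_def polys_over_def coeff_smult[symmetric] simp del: coeff_smult)
  then show "\<exists>u. ?P u" by blast
next
  assume "\<exists>u. ?P u"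
  then obtain u where u: "?P u" by blast
  define w where "w = (\<Sum>i<degree h. monom (u i) i)"
  have cw: "coeff w i = (if i < degree h then u i else 0)" for i
    by (simp add: w_def coeff_sum if_distrib sum.delta')
  have dw: "degree w < degree h"
    using h(3) by (intro degree_lessI) (auto simp: cw)
  have w: "w \<in> polys_over V"
    using u cw ideal_zero[OF V] by (auto simp: polys_over_def)
  have "smult c x = (w ^ p - w) mod h"
  proof (rule poly_eqI)
    fix j
    have "degree ((w ^ p - w) mod h) < degree h"
      using mod_reduced[of "w ^ p - w"] polys_over_diff[OF V polys_over_power[OF V _ w] w] prime_gt_0_nat[OF p(1)]
      by (auto simp: reduced_polys_def)
    then show "coeff (smult c x) j = coeff ((w ^ p - w) mod h) j"
      using u cw coeff_artin_schreier[OF p dw, of j] x by (cases "j < degree h") (auto simp: coeff_eq_0)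
  qed
  then show "smult c x \<in> artin_schreier V h" using artin_schreierI[OF w] by simp
qed

end

end

section \<open>Numbering the grid, and surjectivity from n-dependence\<close>

text \<open>Uniqueness of base-\<open>D\<close> digits, which numbers the points of an n-dimensional
  box without repetition.\<close>

lemma horner_sum_inj:
  fixes D :: nat
  assumes "length xs = length ys" "set xs \<subseteq> {..<D}" "set ys \<subseteq> {..<D}"
    "horner_sum (\<lambda>i. i) D xs = horner_sum (\<lambda>i. i) D ys"
  shows "xs = ys"
  using assms
proof (induction xs ys rule: list_induct2)
  case (Cons x xs y ys)
  then have "x = y"
    by (metis horner_sum_simps(2) insert_subset lessThan_iff list.simps(15) mod_less mod_mult_self2)
  moreover from this have "horner_sum (\<lambda>i. i) D xs = horner_sum (\<lambda>i. i) D ys" using Cons.prems by auto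
  ultimately show ?case using Cons by simp
qed simp

lemma horner_sum_less:
  fixes D :: nat
  assumes "set xs \<subseteq> {..<D}" shows "horner_sum (\<lambda>i. i) D xs < D ^ length xs"
  using assms
proof (induction xs)
  case (Cons x xs)
  then have "x < D" "horner_sum (\<lambda>i. i) D xs + 1 \<le> D ^ length xs" by auto
  then have "x + D * horner_sum (\<lambda>i. i) D xs < D * (horner_sum (\<lambda>i. i) D xs + 1)"
    by simp
  also have "\<dots> \<le> D * D ^ length xs" using \<open>_ + 1 \<le> _\<close> by (rule mult_le_mono2)
  finally show ?case by simp
qed simp

text \<open>An element \<open>s\<close> outside the image lets the pattern lemma prescribe
  membership at \<open>D^n\<close> powers of \<open>t\<close>. Written in base \<open>D\<close>,
  their exponents form a grid on which n-dependence forbids some pattern.\<close>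

theorem (in val_ring) reduced_polys_subset_artin_schreier:
  fixes \<O> :: "'a set"
  assumes p: "prime p" "CHAR('a) = p"
    and V: "ideal_of R V" and h: "h \<in> polys_over R" "lead_coeff h = 1" "degree h > 0"
    and inf: "infinite (residue_class ` R)"
    and n: "n \<ge> 1" and dep: "n_dependent TYPE(nat \<Rightarrow> 'a) n (Th (valued_field \<O>))"
    and V_def: "\<And>v. definable (valued_field \<O>) {v} (\<lambda>e. e v \<in> V)"
  shows "reduced_polys V h \<subseteq> artin_schreier V h"
proof (rule ccontr)
  assume "\<not> reduced_polys V h \<subseteq> artin_schreier V h"
  then obtain s where s: "s \<in> reduced_polys V h" "s \<notin> artin_schreier V h" by blast
  define d where "d = degree h"
  \<comment> \<open>Variables: \<open>d\<close> coordinates of \<open>x\<close>,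
    \<open>d * d\<close> coefficients of the powers \<open>X^(i p) mod h\<close>, \<open>n\<close>
    grid factors; those from \<open>L\<close> on are the quantified coordinates of a
    preimage.\<close>
  define L where "L = d + d * d + n"
  define Q :: "(nat \<Rightarrow> 'a) \<Rightarrow> bool" where "Q e \<longleftrightarrow> (\<forall>i<d. e (L + i) \<in> V) \<and>
    (\<forall>j<d. (\<Prod>k<n. e (d + d * d + k)) * e j = (\<Sum>i<d. e (d + (i * d + j)) * e (L + i) ^ p) - e (L + j))" for e
  have idx: "i * d + j < d * d" if "i < d" "j < d" for i j
  proof -
    have "i * d + j < Suc i * d" using that by simp
    also have "\<dots> \<le> d * d" using that by (intro mult_le_mono1) simp
    finally show ?thesis .
  qed
  have "definable (valued_field \<O>) ({..<L} \<union> {L..<L + d}) Q"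
    unfolding Q_def
    by (intro definable_conj definable_ball definable_mono[OF V_def] definable_eq definable_tm_mult
        definable_tm_prod definable_tm_Var definable_tm_diff definable_tm_sum definable_tm_power)
      (auto simp: L_def add.assoc intro: trans_less_add1 idx)
  then have P: "definable (valued_field \<O>) {..<d + d * d + n} (\<lambda>e. \<exists>u. Q (shadow L d u e))"
    unfolding L_def[symmetric] by (rule definable_ex_tuple[OF _ dom_valued_field])
  \<comment> \<open>\<open>D\<close> is uniform in the parameters and sequences, so \<open>N\<close>
    and then \<open>t\<close> may be chosen depending on it.\<close>
  obtain D where D: "\<And>c a. \<exists>S. \<forall>b. \<exists>\<iota>. length \<iota> = n \<and> set \<iota> \<subseteq> {..<D} \<and>
    \<not> ((\<exists>u. Q (shadow L d u (split_env d (d * d) b c a \<iota>))) \<longleftrightarrow> \<iota> \<in> S)"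
    using n_dependentD[OF dom_valued_field dep n P] by blast
  define N where "N = D ^ n"
  define code where "code = horner_sum (\<lambda>i. i) D"
  obtain t where t: "t \<in> R" "\<And>j. j < N \<Longrightarrow> moore p t j j \<in> R - \<mm>"
    using ex_interpolation_node[OF p(1) inf] by blast
  \<comment> \<open>Decodes the variable \<open>d + (i * d + j)\<close> into the pair
    \<open>i\<close>, \<open>j\<close>.\<close>
  define c where "c v = coeff (monom 1 ((v - d) div d * p) mod h) ((v - d) mod d)" for v
  \<comment> \<open>The weight \<open>D ^ k\<close> makes the product over \<open>k\<close> equal to
    \<open>t\<close> to the power \<open>code \<iota> * p ^ N\<close>.\<close>
  define a where "a k i = t ^ (i * D ^ k * p ^ N)" for k i :: nat
  obtain S where S: "\<And>b. \<exists>\<iota>. length \<iota> = n \<and> set \<iota> \<subseteq> {..<D} \<and>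
    \<not> ((\<exists>u. Q (shadow L d u (split_env d (d * d) b c a \<iota>))) \<longleftrightarrow> \<iota> \<in> S)"
    using D[of c a] by blast
  obtain x where x: "x \<in> reduced_polys V h" and
    pat: "\<And>j. j < N \<Longrightarrow> smult (t ^ (j * p ^ N)) x \<in> artin_schreier V h \<longleftrightarrow>
      (\<exists>\<iota>\<in>S. length \<iota> = n \<and> set \<iota> \<subseteq> {..<D} \<and> code \<iota> = j)"
    using artin_schreier_pattern[where N = N and g = "\<lambda>j. \<exists>\<iota>\<in>S. length \<iota> = n \<and> set \<iota> \<subseteq> {..<D} \<and> code \<iota> = j",
        OF p V h s t]
    by blast
  obtain \<iota> where \<iota>: "length \<iota> = n" "set \<iota> \<subseteq> {..<D}"
    and neq: "\<not> ((\<exists>u. Q (shadow L d u (split_env d (d * d) (coeff x) c a \<iota>))) \<longleftrightarrow> \<iota> \<in> S)"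
    using S by blast
  have "code \<iota> < N" using horner_sum_less[OF \<iota>(2)] \<iota>(1) by (simp add: code_def N_def)
  have "smult (t ^ (code \<iota> * p ^ N)) x \<in> artin_schreier V h \<longleftrightarrow> \<iota> \<in> S"
  proof -
    have "xs = \<iota>" if "length xs = n" "set xs \<subseteq> {..<D}" "code xs = code \<iota>" for xs
      using horner_sum_inj[of xs \<iota> D] that \<iota> by (simp add: code_def)
    then show ?thesis unfolding pat[OF \<open>code \<iota> < N\<close>] using \<iota> by auto
  qed
  moreover have "Q (shadow L d u (split_env d (d * d) (coeff x) c a \<iota>)) \<longleftrightarrow>
    (\<forall>i<d. u i \<in> V) \<and> (\<forall>j<d. t ^ (code \<iota> * p ^ N) * coeff x j =
      (\<Sum>i<d. coeff (monom 1 (i * p) mod h) j * u i ^ p) - u j)" for u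
  proof -
    let ?e = "shadow L d u (split_env d (d * d) (coeff x) c a \<iota>)"
    have "?e (L + i) = u i" if "i < d" for i using that by (simp add: shadow_def)
    moreover have "?e j = coeff x j" if "j < d" for j
      using that by (simp add: shadow_def split_env_def L_def)
    moreover have "?e (d + (i * d + j)) = coeff (monom 1 (i * p) mod h) j" if "i < d" "j < d" for i j
      using that idx[OF that] by (simp add: shadow_def split_env_def L_def c_def)
    moreover have "(\<Prod>k<n. ?e (d + d * d + k)) = t ^ (code \<iota> * p ^ N)"
    proof -
      have "(\<Prod>k<n. ?e (d + d * d + k)) = (\<Prod>k<n. t ^ (\<iota> ! k * D ^ k * p ^ N))"
        by (rule prod.cong) (auto simp: shadow_def split_env_def L_def a_def)
      also have "\<dots> = t ^ (code \<iota> * p ^ N)"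
        unfolding power_sum[symmetric] code_def horner_sum_eq_sum \<iota>(1)
        by (simp add: sum_distrib_right atLeast0LessThan)
      finally show ?thesis .
    qed
    ultimately show ?thesis unfolding Q_def by simp
  qed
  ultimately show False
    using neq smult_in_artin_schreier_iff[OF p V h, of x "t ^ (code \<iota> * p ^ N)"] x
    unfolding d_def[symmetric] by (simp add: reduced_polys_def d_def)
qed

section \<open>Lifting idempotents\<close>

context val_ring
begin

text \<open>Divisibility in \<open>R\<close> is total, so among the finitely many nonzero
  coefficients one divides all the others.\<close>

lemma ex_content:
  fixes y :: "'a poly"
  assumes "y \<noteq> 0"
  shows "\<exists>i. coeff y i \<noteq> 0 \<and> (\<forall>j. coeff y j / coeff y i \<in> R)"
proof -
  have max: "\<exists>x\<in>A. \<forall>y\<in>A. y / x \<in> R" if "finite A" "A \<noteq> {}" "0 \<notin> A" for A :: "'a set"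
    using that
  proof (induction A rule: finite_ne_induct)
    case (singleton x)
    then show ?case using one_in by auto
  next
    case (insert z A)
    then obtain x where x: "x \<in> A" "\<And>y. y \<in> A \<Longrightarrow> y / x \<in> R" by auto
    have nz: "x \<noteq> 0" "z \<noteq> 0" using insert.prems x(1) by auto
    show ?case
    proof (cases "z / x \<in> R")
      case True
      then show ?thesis using x by blast
    next
      case False
      then have xz: "x / z \<in> R" using in_or_inverse_in[of "z / x"] by simp
      have "y / z \<in> R" if "y \<in> A" for y
      proof -
        have "y / z = (y / x) * (x / z)" using nz by simp
        then show ?thesis using mult_in[OF x(2)[OF that] xz] by metis
      qed
      then show ?thesis using nz one_in by (intro bexI[of _ z]) auto
    qed
  qed
  define A where "A = coeff y ` {..degree y} - {0}"
  have "coeff y (degree y) \<in> A" using assms by (simp add: A_def)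
  then have "finite A" "A \<noteq> {}" "0 \<notin> A" by (auto simp: A_def)
  from max[OF this] obtain x where x: "x \<in> A" "\<And>z. z \<in> A \<Longrightarrow> z / x \<in> R" by blast
  from x(1) obtain i where i: "x = coeff y i" "x \<noteq> 0" unfolding A_def by blast
  have "coeff y j / x \<in> R" for j
  proof (cases "coeff y j = 0")
    case False
    then have "coeff y j \<in> A" using le_degree[of y j] by (simp add: A_def)
    then show ?thesis by (rule x(2))
  qed (simp add: zero_in)
  then show ?thesis using i by blast
qed

text \<open>The lifted idempotent \<open>E\<close> cuts out the part of \<open>R[X]/h\<close> over
  the residue root \<open>-1\<close>. There \<open>X\<close> acts as a scalar \<open>r\<close>, and
  this scalar is the root.\<close>

lemma monic_root:
  assumes p: "prime p" "CHAR('a) = p"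
    and h: "h \<in> polys_over R" "lead_coeff h = 1" "degree h > 0"
    and hm: "h - [:1, 1:] * monom 1 (degree h - 1) \<in> polys_over \<mm>"
    and surj: "reduced_polys \<mm> h \<subseteq> artin_schreier \<mm> h"
  shows "\<exists>r\<in>R. poly h r = 0 \<and> r + 1 \<in> \<mm>"
proof -
  note R = ideal_of_self and m = ideal_of_max_ideal
  define d where "d = degree h"
  \<comment> \<open>The kernel of reduction modulo both \<open>h\<close> and \<open>\<mm>\<close>;
    membership of a difference in \<open>N\<close> is the congruence used throughout.\<close>
  define N where "N = {g \<in> polys_over R. g mod h \<in> polys_over \<mm>}"
  have h0: "h \<noteq> 0" using h(3) by auto
  have const: "[:c:] \<in> polys_over R" if "c \<in> R" for c
    using polys_over_monom[OF R that, of 0] by (simp add: monom_0)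
  have lin: "[:b, c:] \<in> polys_over R" if "b \<in> R" "c \<in> R" for b c
    using that zero_in by (auto simp: polys_over_def coeff_pCons split: nat.splits)
  have pow: "g ^ k \<in> polys_over R" if "g \<in> polys_over R" for g k
    using that polys_over_power[OF R, of k g] const[OF one_in] by (cases k) (auto simp: one_pCons)
  have N_diff: "x - y \<in> N" if "x \<in> N" "y \<in> N" for x y
    using that polys_over_diff[OF R] polys_over_diff[OF m] by (auto simp: N_def poly_mod_diff_left)
  have N_add: "x + y \<in> N" if "x \<in> N" "y \<in> N" for x y
    using that polys_over_add[OF R] polys_over_add[OF m] by (auto simp: N_def poly_mod_add_left)
  have N_mult: "g * x \<in> N" if "g \<in> polys_over R" "x \<in> N" for g x
  proof -
    have "(g * x) mod h = (g * (x mod h)) mod h" by (simp add: mod_mult_right_eq)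
    moreover have "g * (x mod h) \<in> polys_over \<mm>"
      using that by (intro polys_over_mult[OF m]) (auto simp: N_def)
    ultimately show ?thesis
      using that polys_over_mult[OF R] polys_over_mod[OF m h(1,2)] by (auto simp: N_def)
  qed
  have N_max: "g \<in> N" if "g \<in> polys_over \<mm>" for g
    using that polys_over_mod[OF m h(1,2)] polys_over_mono[OF m] by (auto simp: N_def)
  have N_dvd: "g \<in> N" if "g \<in> polys_over R" "h dvd g" for g
    using that polys_over_zero[OF m] by (auto simp: N_def)
  \<comment> \<open>The sign in \<open>Y = -X\<close> makes \<open>Y - 1\<close> a multiple of
    \<open>X + 1\<close>, which annihilates \<open>e\<close> modulo \<open>N\<close>.\<close>
  define Y where "Y = [:0, -1 :: 'a:]"
  define e where "e = Y ^ (d - 1)"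
  have YR: "Y \<in> polys_over R" unfolding Y_def by (intro lin zero_in uminus_in one_in)
  have eR: "e \<in> polys_over R" unfolding e_def by (rule pow[OF YR])
  define c where "c = (-1 :: 'a) ^ (d - 1)"
  have "Y = monom (-1) 1" by (simp add: Y_def monom_altdef)
  then have e: "e = smult c (monom 1 (d - 1))" by (simp add: e_def c_def monom_power smult_monom)
  have c: "c \<in> R" "c * c = 1"
    using power_in[OF uminus_in[OF one_in]] by (auto simp: c_def power_mult_distrib[symmetric])
  then have cu: "c \<in> R - \<mm>" by (auto simp: max_ideal_def)
  have Xe: "[:1, 1:] * e \<in> N"
  proof -
    have "[:1, 1:] * e = smult c h - smult c (h - [:1, 1:] * monom 1 (d - 1))"
      unfolding e by (simp add: smult_diff_right)
    moreover have "smult c h \<in> N" by (intro N_dvd polys_over_smult[OF R] c h) (simp add: dvd_smult)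
    moreover have "smult c (h - [:1, 1:] * monom 1 (d - 1)) \<in> N"
      using polys_over_smult[OF m c(1) hm] by (intro N_max) (simp add: d_def)
    ultimately show ?thesis using N_diff by simp
  qed
  \<comment> \<open>Here \<open>e\<close> is a power of \<open>Y\<close>, so the difference is
    \<open>e\<close> times a multiple of \<open>Y - 1 = -(X + 1)\<close>.\<close>
  have e_pow: "e ^ Suc k - e \<in> N" for k
  proof -
    have "e ^ Suc k - e = e * (Y ^ ((d - 1) * k) - 1)" by (simp only: e_def power_mult power_Suc right_diff_distrib mult_1_right)
    also have "\<dots> = (- (\<Sum>i<(d - 1) * k. Y ^ i)) * ([:1, 1:] * e)"
    proof -
      have "Y - 1 = - [:1, 1:]" by (simp add: Y_def one_pCons)
      then show ?thesis
        unfolding power_diff_1_eq by (simp only: mult_minus_left mult_minus_right mult_ac)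
    qed
    also have "\<dots> \<in> N" by (intro N_mult Xe polys_over_uminus[OF R] polys_over_sum[OF R] pow YR)
    finally show ?thesis .
  qed
  have "(e ^ p - e) mod h \<in> reduced_polys \<mm> h"
  proof -
    have "e ^ p - e \<in> N" using e_pow[of "p - 1"] prime_gt_0_nat[OF p(1)] by simp
    then show ?thesis
      using degree_mod_less[OF h0, of "e ^ p - e"] h(3) by (auto simp: N_def reduced_polys_def)
  qed
  then obtain u where u: "u \<in> polys_over \<mm>" "(e ^ p - e) mod h = (u ^ p - u) mod h"
    using surj by (auto simp: artin_schreier_def p(2) reduced_polys_def)
  \<comment> \<open>Subtracting the Artin-Schreier preimage turns \<open>e\<close> into an exact
    fixed point of Frobenius modulo \<open>h\<close>.\<close>
  define e' where "e' = e - u"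
  have e'R: "e' \<in> polys_over R" unfolding e'_def by (intro polys_over_diff[OF R] eR polys_over_mono[OF m u(1)])
  have e'p: "h dvd e' ^ p - e'"
  proof -
    have "prime CHAR('a poly)" "p = CHAR('a poly)" by (simp_all only: CHAR_poly_eq p)
    from freshmans_dream[OF this, of e' u] have "e ^ p = e' ^ p + u ^ p" by (simp add: e'_def)
    then have "e' ^ p - e' = (e ^ p - e) - (u ^ p - u)" by (simp add: e'_def)
    then show ?thesis using u(2) by (simp add: mod_eq_0_iff_dvd[symmetric] poly_mod_diff_left)
  qed
  \<comment> \<open>If \<open>e'^p = e'\<close>, then \<open>e'^(p-1)\<close> is idempotent, since
    \<open>E0 * E0 - E0 = e'^(p-2) * (e'^p - e')\<close>.\<close>
  define E0 where "E0 = e' ^ (p - 1)"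
  define E where "E = E0 mod h"
  have p2: "p \<ge> 2" using prime_ge_2_nat[OF p(1)] .
  have E0R: "E0 \<in> polys_over R" unfolding E0_def by (rule pow[OF e'R])
  have ER: "E \<in> polys_over R" unfolding E_def by (rule polys_over_mod[OF R h(1,2) E0R])
  have dE: "degree E < d" unfolding E_def d_def using degree_mod_less[OF h0, of E0] h(3) by auto
  have "h dvd E0 * E0 - E0"
  proof -
    obtain k where k: "p = Suc (Suc k)" using p2 by (metis Suc_le_D numeral_2_eq_2 Suc_le_mono)
    have "E0 * E0 - E0 = e' ^ k * (e' ^ p - e')"
      by (simp add: E0_def k algebra_simps)
    then show ?thesis using e'p by simp
  qed
  moreover have "(E * E - E) mod h = (E0 * E0 - E0) mod h"
    by (simp add: E_def poly_mod_diff_left mod_mult_eq)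
  ultimately have EE: "h dvd E * E - E" by (simp add: mod_eq_0_iff_dvd[symmetric])
  have Ee: "E - e \<in> polys_over \<mm>"
  proof -
    have "e' ^ k - e ^ k \<in> N" for k
    proof (induction k)
      case 0
      then show ?case using N_max[OF polys_over_zero[OF m]] by simp
    next
      case (Suc k)
      have "e' ^ Suc k - e ^ Suc k = e' * (e' ^ k - e ^ k) - e ^ k * u"
        by (simp add: e'_def algebra_simps)
      then show ?case using N_diff[OF N_mult[OF e'R Suc] N_mult[OF pow[OF eR] N_max[OF u(1)]]] by simp
    qed
    moreover have "e ^ (p - 1) - e \<in> N" using e_pow[of "p - 2"] p2 by (simp add: Suc_diff_Suc numeral_2_eq_2)
    ultimately have "E0 - e \<in> N" using N_add[of "e' ^ (p - 1) - e ^ (p - 1)" "e ^ (p - 1) - e"] by (simp add: E0_def)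
    moreover have "e mod h = e" using h(3) by (intro mod_poly_less) (simp add: e degree_monom_eq d_def)
    ultimately show ?thesis by (simp add: N_def poly_mod_diff_left E_def)
  qed
  have XE: "[:1, 1:] * E \<in> N"
    using N_add[OF Xe N_mult[OF lin[OF one_in one_in] N_max[OF Ee]]] by (simp add: algebra_simps)
  define \<epsilon> where "\<epsilon> = coeff E (d - 1)"
  \<comment> \<open>The top coefficient of \<open>E\<close> agrees modulo \<open>\<mm>\<close> with
    that of \<open>e\<close>, which is \<open>1\<close> or \<open>-1\<close>.\<close>
  have \<epsilon>: "\<epsilon> \<in> R - \<mm>"
  proof (rule unit_cong[OF cu])
    show "\<epsilon> - c \<in> \<mm>" using Ee unfolding polys_over_def \<epsilon>_def e by (auto dest: spec[of _ "d - 1"])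
  qed
  \<comment> \<open>Chosen to cancel the coefficient of \<open>X^(d-1)\<close> in
    \<open>(X - r) E mod h\<close>; the remainder \<open>y\<close> will turn out to be zero.\<close>
  define r where "r = coeff (([:0, 1:] * E) mod h) (d - 1) / \<epsilon>"
  have rR: "r \<in> R"
    unfolding r_def
    using polys_over_mod[OF R h(1,2) polys_over_mult[OF R lin[OF zero_in one_in] ER]] \<epsilon>
    by (intro divide_unit_in) (auto simp: polys_over_def)
  define y where "y = ([:-r, 1:] * E) mod h"
  have dy: "degree y < d" unfolding y_def d_def using degree_mod_less[OF h0, of "[:-r, 1:] * E"] h(3) by auto
  have y_top: "coeff y (d - 1) = 0"
  proof -
    have "[:-r, 1:] * E = [:0, 1:] * E - smult r E" by simp
    then have "y = ([:0, 1:] * E) mod h - smult r E"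
      unfolding y_def using dE by (simp add: poly_mod_diff_left mod_smult_left mod_poly_less d_def)
    then show ?thesis using unit_nonzero[OF \<epsilon>] by (simp add: r_def \<epsilon>_def)
  qed
  have Ey: "h dvd E * y - y"
  proof -
    have "(E * y - y) mod h = ([:-r, 1:] * (E * E - E)) mod h"
      by (simp only: y_def poly_mod_diff_left right_diff_distrib left_diff_distrib mod_mult_right_eq mod_mod_trivial mult_ac)
    then show ?thesis using EE by (metis dvd_mult mod_eq_0_iff_dvd)
  qed
  have "y = 0"
  proof (rule ccontr)
    assume "y \<noteq> 0"
    then obtain i where i: "coeff y i \<noteq> 0" "\<And>j. coeff y j / coeff y i \<in> R" using ex_content by blast
    \<comment> \<open>Dividing by the content keeps the coefficients in \<open>R\<close> and makes
      coefficient \<open>i\<close> equal to \<open>1\<close>, so \<open>z\<close> cannot vanish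
      modulo \<open>\<mm>\<close>.\<close>
    define z where "z = smult (inverse (coeff y i)) y"
    have zR: "z \<in> polys_over R" using i by (simp add: polys_over_def z_def divide_inverse mult.commute)
    have "E * z - z = smult (inverse (coeff y i)) (E * y - y)" by (simp add: z_def smult_diff_right)
    then have "h dvd E * z - z" using Ey by (metis dvd_smult)
    then have "E * z - z \<in> N" using zR ER by (intro N_dvd polys_over_diff[OF R] polys_over_mult[OF R])
    then have "z * ([:1, 1:] * E) - [:1, 1:] * (E * z - z) \<in> N"
      by (rule N_diff[OF N_mult[OF zR XE] N_mult[OF lin[OF one_in one_in]]])
    \<comment> \<open>Since \<open>E\<close> fixes \<open>z\<close> modulo \<open>h\<close> and is
      annihilated by \<open>X + 1\<close> modulo \<open>N\<close>, so is \<open>z\<close>.\<close>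
    moreover have "z * (b * E) - b * (E * z - z) = b * z" for b by (simp add: algebra_simps)
    ultimately have "[:1, 1:] * z \<in> N" by (simp only:)
    \<comment> \<open>The missing top coefficient gives \<open>(X + 1) z\<close> degree below
      \<open>d\<close>, so it is its own remainder and itself has coefficients in
      \<open>\<mm>\<close>.\<close>
    moreover have "degree ([:1, 1:] * z) < d"
    proof (rule degree_lessI)
      show "[:1, 1:] * z \<noteq> 0 \<or> 0 < d" using h(3) by (simp add: d_def)
      have "coeff z j = 0" if "j \<ge> d - 1" for j
        using that y_top dy by (cases "j = d - 1") (auto simp: z_def coeff_eq_0)
      then show "\<forall>k\<ge>d. coeff ([:1, 1:] * z) k = 0"
        by (auto simp: coeff_pCons split: nat.split)
    qed
    ultimately have Xz: "[:1, 1:] * z \<in> polys_over \<mm>" by (simp only: N_def mod_poly_less d_def mem_Collect_eq)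
    have "coeff z j \<in> \<mm>" for j
    proof (induction j)
      case 0
      have "coeff ([:1, 1:] * z) 0 \<in> \<mm>" using Xz by (simp only: polys_over_def mem_Collect_eq)
      then show ?case by simp
    next
      case (Suc j)
      have "coeff ([:1, 1:] * z) (Suc j) \<in> \<mm>" using Xz by (simp only: polys_over_def mem_Collect_eq)
      then have "coeff z (Suc j) + coeff z j \<in> \<mm>" by simp
      from diff_in_max_ideal[OF this Suc] show ?case by simp
    qed
    from this[of i] show False using i(1) one_notin_max_ideal by (simp add: z_def)
  qed
  then have hE: "h dvd [:-r, 1:] * E" by (simp add: y_def mod_eq_0_iff_dvd)
  \<comment> \<open>Otherwise \<open>X - r\<close> divides the cofactor and can be cancelled, making
    \<open>h\<close> divide the nonzero \<open>E\<close> of smaller degree.\<close>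
  have "poly h r = 0"
  proof (rule ccontr)
    assume hr: "poly h r \<noteq> 0"
    from hE obtain q where q: "[:-r, 1:] * E = h * q" by (elim dvdE)
    then have "poly ([:-r, 1:] * E) r = poly (h * q) r" by (simp only:)
    then have "poly q r = 0" using hr by (simp add: poly_mult)
    then have "[:-r, 1:] dvd q" by (simp add: poly_eq_0_iff_dvd)
    then obtain q' where "q = [:-r, 1:] * q'" by (elim dvdE)
    then have "[:-r, 1:] * E = [:-r, 1:] * (h * q')" using q by (simp only: mult_ac)
    then have "E = h * q'" by (subst (asm) mult_cancel_left) simp
    moreover have "E \<noteq> 0" using unit_nonzero[OF \<epsilon>] by (auto simp: \<epsilon>_def)
    ultimately show False using dE by (auto simp: degree_mult_eq d_def)
  qed
  moreover have "r + 1 \<in> \<mm>"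
  proof -
    \<comment> \<open>As \<open>(X - r) E\<close> vanishes modulo \<open>h\<close>,
      \<open>X + 1\<close> acts on \<open>E\<close> as \<open>r + 1\<close>; comparing top
      coefficients puts \<open>(r + 1) * \<epsilon>\<close> into \<open>\<mm>\<close>.\<close>
    have "[:1, 1:] * E = [:-r, 1:] * E + smult (r + 1) E" by (simp add: smult_add_left)
    then have "([:1, 1:] * E) mod h = smult (r + 1) E"
      using hE dE by (simp only: poly_mod_add_left mod_eq_0_iff_dvd[THEN iffD2] mod_smult_left mod_poly_less d_def add_0)
    then have "(r + 1) * \<epsilon> \<in> \<mm>" using XE by (simp add: N_def polys_over_def \<epsilon>_def)
    then show ?thesis using max_ideal_prime[OF add_in[OF rR one_in]] \<epsilon> by blast
  qed
  ultimately show ?thesis using rR by blast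
qed

end

section \<open>Reduction of Hensel's lemma to monic polynomials, and the residue field\<close>

context val_ring
begin

text \<open>After translating \<open>a\<close> to \<open>0\<close>, write
  \<open>g = c0 + c1 X + ...\<close>. The substitution \<open>x = c0 / (c1 r)\<close> turns
  \<open>r^d * g(x)\<close> into \<open>c0 * h(r)\<close>, with \<open>h\<close> monic and congruent
  to \<open>X^d + X^(d-1)\<close> modulo \<open>\<mm>\<close>.\<close>

lemma henselianI:
  assumes monic: "\<And>h. h \<in> polys_over R \<Longrightarrow> lead_coeff h = 1 \<Longrightarrow> degree h > 0 \<Longrightarrow>
    h - [:1, 1:] * monom 1 (degree h - 1) \<in> polys_over \<mm> \<Longrightarrow> \<exists>r\<in>R. poly h r = 0 \<and> r + 1 \<in> \<mm>"
  shows "henselian R"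
  unfolding henselian_def
proof (intro conjI allI impI valuation_ring)
  fix f a
  assume fa: "(\<forall>i. coeff f i \<in> R) \<and> a \<in> R \<and> poly f a \<in> \<mm> \<and> poly (pderiv f) a \<notin> \<mm>"
  define g where "g = pcompose f [:a, 1:]"
  have "f \<in> polys_over R" using fa by (simp add: polys_over_def)
  then have gR: "g \<in> polys_over R" unfolding g_def
  proof (induction f)
    case 0
    then show ?case by simp
  next
    case (pCons b f)
    have c: "coeff (pCons b f) i \<in> R" for i using pCons.prems unfolding polys_over_def by blast
    have "b \<in> R" "f \<in> polys_over R"
      using c[of 0] c[of "Suc _"] by (auto simp: polys_over_def)
    moreover have "[:b:] \<in> polys_over R" "[:a, 1:] \<in> polys_over R"
      using \<open>b \<in> R\<close> fa zero_in one_in by (auto simp: polys_over_def coeff_pCons split: nat.splits)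
    ultimately show ?case unfolding pcompose_pCons
      by (intro polys_over_add[OF ideal_of_self] polys_over_mult[OF ideal_of_self] pCons.IH)
  qed
  have poly_g: "poly g x = poly f (a + x)" for x by (simp add: g_def poly_pcompose add.commute)
  define c0 where "c0 = coeff g 0"
  define c1 where "c1 = coeff g 1"
  have c0: "c0 = poly f a" using poly_g[of 0] by (simp add: c0_def poly_0_coeff_0)
  have "poly (pderiv g) 0 = poly (pderiv f) a"
    by (simp add: g_def pderiv_pcompose poly_pcompose pderiv_pCons)
  then have c1: "c1 = poly (pderiv f) a" by (simp add: c1_def poly_0_coeff_0 coeff_pderiv)
  have c0m: "c0 \<in> \<mm>" using fa c0 by simp
  have c1u: "c1 \<in> R - \<mm>"
  proof -
    have "c1 \<in> R" using gR unfolding c1_def polys_over_def by blast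
    then show ?thesis using fa c1 by simp
  qed
  show "\<exists>b\<in>R. poly f b = 0 \<and> b - a \<in> \<mm>"
  proof (cases "c0 = 0")
    case True
    then show ?thesis using fa c0 zero_in_max_ideal by (intro bexI[of _ a]) auto
  next
    case c0nz: False
    define d where "d = degree g"
    have c1nz: "c1 \<noteq> 0" using unit_nonzero[OF c1u] .
    have "d > 0" unfolding d_def using c1nz le_degree[of g 1] by (simp add: c1_def)
    \<comment> \<open>\<open>\<eta> i\<close> is the coefficient of \<open>X^(d-i)\<close> in
      \<open>h\<close>. The power of \<open>c0 / c1\<close> puts it into \<open>\<mm>\<close> for
      \<open>i \<ge> 2\<close>, and \<open>\<eta> 1 = 1\<close>.\<close>
    define \<eta> where "\<eta> i = (if i = 0 then 1 else coeff g i / c1 * (c0 / c1) ^ (i - 1))" for i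
    have q: "c0 / c1 \<in> \<mm>"
      using mult_in_max_ideal[OF unit_inverse_in[OF c1u] c0m] by (simp add: divide_inverse mult.commute)
    have gi: "coeff g i / c1 \<in> R" for i
      using gR c1u by (intro divide_unit_in) (auto simp: polys_over_def)
    have \<eta>R: "\<eta> i \<in> R" for i
      using one_in mult_in[OF gi power_in[OF max_idealD[OF q]], of i "i - 1"] by (simp add: \<eta>_def)
    have \<eta>1: "\<eta> 1 = 1" using c1nz by (simp add: \<eta>_def c1_def)
    have \<eta>m: "\<eta> i \<in> \<mm>" if i: "i \<ge> 2" for i
    proof -
      obtain k where k: "i = Suc (Suc k)" using i by (metis Suc_le_D numeral_2_eq_2 Suc_le_mono)
      have "\<eta> i = (coeff g i / c1 * (c0 / c1) ^ k) * (c0 / c1)" by (simp add: \<eta>_def k)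
      then show ?thesis using mult_in_max_ideal[OF mult_in[OF gi power_in[OF max_idealD[OF q]]] q] by metis
    qed
    define h where "h = (\<Sum>i\<le>d. monom (\<eta> i) (d - i))"
    have ch: "coeff h k = (if k \<le> d then \<eta> (d - k) else 0)" for k
    proof -
      have "coeff h k = (\<Sum>i\<le>d. if i = d - k \<and> k \<le> d then \<eta> i else 0)"
        unfolding h_def coeff_sum by (intro sum.cong) auto
      then show ?thesis by (cases "k \<le> d") simp_all
    qed
    have dh: "degree h = d"
      using ch[of d] ch by (intro antisym degree_le le_degree) (auto simp: \<eta>_def)
    have "\<exists>r\<in>R. poly h r = 0 \<and> r + 1 \<in> \<mm>"
    proof (rule monic)
      show "h \<in> polys_over R" using \<eta>R zero_in by (simp add: polys_over_def ch)
      show "lead_coeff h = 1" by (simp add: dh ch \<eta>_def)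
      show "degree h > 0" using \<open>d > 0\<close> dh by simp
      show "h - [:1, 1:] * monom 1 (degree h - 1) \<in> polys_over \<mm>"
        unfolding polys_over_def
      proof (rule CollectI, rule allI)
        fix k
        have "coeff ([:1, 1:] * monom 1 (d - 1)) k = (if k = d \<or> k = d - 1 then 1 else 0 :: 'a)"
          using \<open>d > 0\<close> by (auto simp: coeff_pCons split: nat.split)
        then have c: "coeff (h - [:1, 1:] * monom 1 (degree h - 1)) k =
          (if k \<le> d then \<eta> (d - k) else 0) - (if k = d \<or> k = d - 1 then 1 else 0)"
          by (simp only: coeff_diff dh ch)
        consider "k = d" | "k = d - 1" | "k > d" | "k \<le> d" "k \<noteq> d" "k \<noteq> d - 1" by linarith
        then show "coeff (h - [:1, 1:] * monom 1 (degree h - 1)) k \<in> \<mm>"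
        proof cases
          case 1
          then show ?thesis unfolding c using zero_in_max_ideal by (simp add: \<eta>_def)
        next
          case 2
          then have "d - k = 1" using \<open>d > 0\<close> by simp
          then show ?thesis unfolding c using 2 \<eta>1 zero_in_max_ideal by simp
        next
          case 3
          then have "\<not> k \<le> d" "k \<noteq> d" "k \<noteq> d - 1" by linarith+
          then show ?thesis unfolding c using zero_in_max_ideal by simp
        next
          case 4
          then show ?thesis unfolding c using \<eta>m[of "d - k"] by simp
        qed
      qed
    qed
    then obtain r where r: "r \<in> R" "poly h r = 0" "r + 1 \<in> \<mm>" by blast
    have "-1 \<in> R - \<mm>"
      using uminus_in[OF one_in] one_notin_max_ideal uminus_in_max_ideal[of "-1"] by auto
    then have ru: "r \<in> R - \<mm>" by (rule unit_cong) (use r(3) in simp)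
    define x where "x = c0 / c1 / r"
    have rnz: "r \<noteq> 0" using unit_nonzero[OF ru] .
    have xm: "x \<in> \<mm>"
      using mult_in_max_ideal[OF unit_inverse_in[OF ru] q] by (simp add: x_def divide_inverse mult.commute)
    have "r ^ d * poly g x = c0 * poly h r"
    proof -
      have "r ^ d * (coeff g i * x ^ i) = c0 * (\<eta> i * r ^ (d - i))" if "i \<le> d" for i
      proof (cases i)
        case 0
        then show ?thesis by (simp add: \<eta>_def c0_def)
      next
        case (Suc k)
        have "r ^ d = r ^ (d - i) * r ^ i" using that by (simp add: power_add[symmetric])
        then show ?thesis using rnz c1nz Suc by (simp add: \<eta>_def x_def power_divide power_mult_distrib)
      qed
      then have "(\<Sum>i\<le>d. r ^ d * (coeff g i * x ^ i)) = (\<Sum>i\<le>d. c0 * (\<eta> i * r ^ (d - i)))" by simp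
      then show ?thesis
        by (simp add: poly_altdef[of g] d_def[symmetric] h_def poly_sum poly_monom sum_distrib_left)
    qed
    then have "poly g x = 0" using r(2) rnz by simp
    then show ?thesis using poly_g xm fa max_idealD by (intro bexI[of _ "a + x"] conjI) (auto intro: add_in)
  qed
qed

text \<open>Solvability of \<open>y^p - y = z\<close> passes to the residue field. There
  \<open>0\<close> and \<open>1\<close> have the same image, which a surjection of a finite set onto
  itself does not allow.\<close>

lemma infinite_residue_classes:
  assumes p: "prime p" "CHAR('a) = p" and AS_closed: "\<And>z :: 'a. \<exists>y. y ^ p - y = z"
  shows "infinite (residue_class ` R)"
proof
  assume fin: "finite (residue_class ` R)"
  have p2: "p \<ge> 2" using prime_ge_2_nat[OF p(1)] .
  \<comment> \<open>Integrality: for \<open>y\<close> outside \<open>R\<close> the inverse lies in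
    \<open>\<mm>\<close>, and dividing the equation by \<open>y^p\<close> would put \<open>1\<close>
    into \<open>\<mm>\<close>.\<close>
  have root_in: "y \<in> R" if "y ^ p - y \<in> R" for y
  proof (rule ccontr)
    assume y: "y \<notin> R"
    then have i: "inverse y \<in> R" "y \<noteq> 0" using in_or_inverse_in[of y] zero_in by auto
    have im: "inverse y \<in> \<mm>" using unit_inverse_in[of "inverse y"] i y by auto
    obtain k where k: "p = Suc (Suc k)" using p2 by (metis Suc_le_D numeral_2_eq_2 Suc_le_mono)
    have "1 = (inverse y ^ k + (y ^ p - y) * inverse y ^ Suc k) * inverse y"
      using i(2) by (simp add: k field_simps)
    moreover have "\<dots> \<in> \<mm>" by (intro mult_in_max_ideal im add_in mult_in that power_in i)
    ultimately show False using one_notin_max_ideal by simp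
  qed
  \<comment> \<open>\<open>T\<close> contains one representative per class, so that the map induced
    on the residue field becomes \<open>F\<close> on \<open>T\<close>.\<close>
  obtain T where T: "T \<subseteq> R" "inj_on residue_class T" "residue_class ` R = residue_class ` T"
    using subset_image_inj[THEN iffD1, OF subset_refl, of R residue_class]
    by (elim exE conjE) (rule that)
  define F where "F t = residue_class (t ^ p - t)" for t
  have frob_in: "t ^ p - t \<in> R" if "t \<in> R" for t using that by (intro diff_in power_in)
  have F_cong: "F x = F y" if "x \<in> R" "y \<in> R" "residue_class x = residue_class y" for x y
  proof -
    have m: "x - y \<in> \<mm>" using that residue_class_eq_iff by blast
    have "prime CHAR('a)" "p = CHAR('a)" by (simp_all only: p)
    from freshmans_dream[OF this, of "x - y" y]
    have "(x ^ p - x) - (y ^ p - y) = (x - y) ^ p - (x - y)" by simp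
    also have "\<dots> = (x - y) ^ (p - 1) * (x - y) - (x - y)"
      by (simp only: power_minus_mult[OF prime_gt_0_nat[OF p(1)]])
    also have "\<dots> \<in> \<mm>" by (intro diff_in_max_ideal mult_in_max_ideal m power_in diff_in that)
    finally show ?thesis unfolding F_def using residue_class_eq_iff frob_in that by blast
  qed
  have rep: "\<exists>t\<in>T. residue_class t = residue_class x" if "x \<in> R" for x
    using T(3) that by (metis image_iff)
  have "residue_class ` R = F ` T"
  proof (rule subset_antisym)
    show "F ` T \<subseteq> residue_class ` R" using T(1) frob_in by (auto simp: F_def)
    show "residue_class ` R \<subseteq> F ` T"
    proof (rule image_subsetI)
      fix z assume z: "z \<in> R"
      obtain y where y: "y ^ p - y = z" using AS_closed by blast
      have "y \<in> R" by (rule root_in) (simp add: y z)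
      then obtain t where t: "t \<in> T" "residue_class t = residue_class y" using rep by blast
      then have "F y = F t" using F_cong[of t y] \<open>y \<in> R\<close> T(1) by auto
      moreover have "residue_class z = F y" by (simp add: F_def y)
      ultimately show "residue_class z \<in> F ` T" using t(1) by simp
    qed
  qed
  then have "card (F ` T) = card T" using T(3) card_image[OF T(2)] by simp
  moreover have "finite T" using fin T(2,3) by (metis finite_imageD)
  ultimately have inj: "inj_on F T" by (simp add: eq_card_imp_inj_on)
  obtain t0 t1 where t: "t0 \<in> T" "residue_class t0 = residue_class 0" "t1 \<in> T" "residue_class t1 = residue_class 1"
    using rep zero_in one_in by meson
  have "F t0 = F 0" "F t1 = F 1" using F_cong t T(1) zero_in one_in by (meson subsetD)+
  moreover have "F 0 = F 1" using p2 by (simp add: F_def power_0_left)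
  ultimately have "t0 = t1" using inj t by (simp add: inj_on_def)
  then have "1 - 0 \<in> \<mm>" using t residue_class_eq_iff[OF one_in zero_in] by simp
  then show False using one_notin_max_ideal by simp
qed

end

text \<open>The case \<open>R = V = K\<close> and \<open>h = X\<close>: the quotient
  \<open>K[X]/(X)\<close> is \<open>K\<close>, and the trivial valuation has residue field
  \<open>K\<close>, infinite by assumption.\<close>

lemma artin_schreier_closed:
  fixes \<O> :: "'a::field set"
  assumes p: "prime p" "CHAR('a) = p" and inf: "infinite (UNIV :: 'a set)"
    and n: "n \<ge> 1" and dep: "n_dependent TYPE(nat \<Rightarrow> 'a) n (Th (valued_field \<O>))"
  shows "\<exists>y. y ^ p - y = (z :: 'a)"
proof -
  interpret K: val_ring "UNIV :: 'a set" by standard (simp add: valuation_ring_def)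
  have "max_ideal (UNIV :: 'a set) = {0}"
    by (auto simp: max_ideal_def) (metis right_inverse)
  then have "K.residue_class x = {x}" for x by (auto simp: K.residue_class_def)
  then have "inj K.residue_class" by (simp add: inj_on_def)
  then have "infinite (range K.residue_class)" using inf by (simp add: finite_image_iff)
  moreover have "definable (valued_field \<O>) {v} (\<lambda>e. e v \<in> UNIV)" for v by (simp add: definable_True)
  ultimately have "reduced_polys UNIV [:0, 1 :: 'a:] \<subseteq> artin_schreier UNIV [:0, 1:]"
    by (intro K.reduced_polys_subset_artin_schreier[OF p K.ideal_of_self _ _ _ _ n dep]) (auto simp: polys_over_def)
  then have "[:z:] \<in> artin_schreier UNIV [:0, 1:]" by (auto simp: reduced_polys_def polys_over_def)
  then obtain w where w: "degree w < degree [:0, 1 :: 'a:]" "[:z:] = (w ^ p - w) mod [:0, 1:]"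
    unfolding artin_schreier_def reduced_polys_def p(2) by blast
  then have "degree w = 0" by simp
  then obtain y where "w = [:y:]" by (rule degree_eq_zeroE)
  then have "[:z:] = [:y ^ p - y:]" using w(2) by (simp add: mod_poly_less poly_const_pow)
  then show ?thesis by auto
qed

theorem theorem3p1:
  fixes \<O> :: "'a::field set" and n :: nat
  assumes "infinite (UNIV :: 'a set)"
    and "CHAR('a) > 0"
    and "valuation_ring \<O>"
    and "n \<ge> 1"
    and "n_dependent TYPE(nat \<Rightarrow> 'a) n (Th (valued_field \<O>))"
  shows "henselian \<O>"
proof -
  interpret val_ring \<O> by standard (rule assms(3))
  define p where "p = CHAR('a)"
  have p: "prime p" "CHAR('a) = p"
    using prime_CHAR_semidom[OF assms(2)] by (simp_all add: p_def)
  have "infinite (residue_class ` \<O>)"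
    by (rule infinite_residue_classes[OF p artin_schreier_closed[OF p assms(1,4,5)]])
  \<comment> \<open>The second application takes \<open>\<O>\<close> itself and its maximal ideal,
    now that the residue field is known to be infinite.\<close>
  from reduced_polys_subset_artin_schreier[OF p ideal_of_max_ideal _ _ _ this assms(4,5) definable_max_ideal]
  show ?thesis by (intro henselianI monic_root[OF p])
qed

end
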